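(* There is an absolute constant $C>0$ such that the following holds. Let $R\ge2$ be an integer, let $R_*$ be the odd and $R_{**}$ the even element of $\{R,R+1\}$, and let $\alpha$ be an irrational number whose regular continued fraction expansion is (eventually) periodic with period block $R_{**},R_*,R_*,R_*,R_*$. Then $$\left|\rho(\alpha)-\frac14\left(1-\frac{2}{R_*}-\frac{2}{R_*^2}\right)\right|\le\frac{C}{R_*^3}.$$
   Context: For real $x$, $\|x\|$ is the distance to the nearest integer. $M(\alpha,\gamma):=\liminf_{|n|\to\infty}|n|\,\|n\alpha-\gamma\|$ ($n\in\mathbb Z$), and $\rho(\alpha):=\sup\{M(\alpha,\gamma):\gamma\in\mathbb R\setminus(\mathbb Z+\alpha\mathbb Z)\}$. The regular continued fraction expansion is $\alpha=[a_0;a_1,a_2,\dots]=a_0+\cfrac1{a_1+\cfrac1{a_2+\cdots}}$ with $a_0=\lfloor\alpha\rfloor$, $a_i\ge1$. *)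

theory Defs
  imports "HOL-Analysis.Analysis"
begin

definition dist_int :: "real \<Rightarrow> real" where
  "dist_int x = infdist x \<int>"

(* The filter is |n| -> infinity over all integers n, positive and negative.  Both quantities below
   are formed in the extended reals, so that the lower limit and the supremum always exist. *)
definition approx_const :: "real \<Rightarrow> real \<Rightarrow> ereal" where
  "approx_const \<alpha> \<gamma> =
     Liminf (filtercomap (\<lambda>n::int. \<bar>n\<bar>) at_top)
       (\<lambda>n. ereal (\<bar>real_of_int n\<bar> * dist_int (real_of_int n * \<alpha> - \<gamma>)))"

definition rho :: "real \<Rightarrow> ereal" where
  "rho \<alpha> = (SUP \<gamma> \<in> - {real_of_int m + real_of_int k * \<alpha> | m k. True}. approx_const \<alpha> \<gamma>)"

(* cf_convergent a n = [a 0; a 1, ..., a n] *)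
fun cf_convergent :: "(nat \<Rightarrow> int) \<Rightarrow> nat \<Rightarrow> real" where
  "cf_convergent a 0 = real_of_int (a 0)"
| "cf_convergent a (Suc n) = real_of_int (a 0) + 1 / cf_convergent (\<lambda>i. a (Suc i)) n"

(* Only infinite expansions, i.e. those of irrational numbers, are covered. *)
definition regular_cf :: "real \<Rightarrow> (nat \<Rightarrow> int) \<Rightarrow> bool" where
  "regular_cf \<alpha> a \<longleftrightarrow>
     a 0 = \<lfloor>\<alpha>\<rfloor> \<and> (\<forall>i\<ge>1. a i \<ge> 1) \<and> cf_convergent a \<longlonglongrightarrow> \<alpha>"

definition eventually_periodic :: "'a list \<Rightarrow> (nat \<Rightarrow> 'a) \<Rightarrow> bool" where
  "eventually_periodic block a \<longleftrightarrow>
     block \<noteq> [] \<and> (\<exists>N. \<forall>k. a (N + k) = block ! (k mod length block))"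

end

theory Submission
  imports Defs
begin

text \<open>
  Consider the grid of points \<open>(n, n\<alpha> - m - \<gamma>)\<close> and, for consecutive convergents, the basis
  \<open>e\<^sub>k = (q\<^sub>k, q\<^sub>k\<alpha> - p\<^sub>k)\<close>, \<open>e\<^sub>k\<^sub>-\<^sub>1\<close> of the underlying lattice. After rescaling the axes these vectors
  are \<open>(1, -\<theta>\<^sub>k)\<close> and \<open>(\<phi>\<^sub>k, 1)\<close>, where \<open>\<theta>\<^sub>k = [0; a\<^sub>k\<^sub>+\<^sub>1, \<dots>]\<close> and \<open>\<phi>\<^sub>k = [0; a\<^sub>k, \<dots>, a\<^sub>1]\<close>. A grid cell
  at level \<open>k\<close> has the vertices \<open>(\<plusminus>e\<^sub>k \<plusminus> e\<^sub>k\<^sub>-\<^sub>1 + (S\<^sub>k, T\<^sub>k)) / 2\<close>, and passing to the next level is governed by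
  a digit \<open>\<tau> \<equiv> a\<^sub>k\<^sub>+\<^sub>1 (mod 2)\<close> with \<open>S\<^sub>k\<^sub>+\<^sub>1 = \<phi>\<^sub>k\<^sub>+\<^sub>1(\<tau> + S\<^sub>k)\<close> and \<open>T\<^sub>k = \<theta>\<^sub>k(\<tau> - T\<^sub>k\<^sub>+\<^sub>1)\<close>.

  Put \<open>x = 1 / R\<^sub>*\<close>. To first order the smallest of the four vertex products is
  \<open>1/4 (1 - (|\<tau>\<^sub>k| + |\<tau>\<^sub>k\<^sub>+\<^sub>1|) x)\<close>, so a good \<open>\<gamma>\<close> has digits \<open>0\<close> at the even quotients and \<open>\<plusminus>1\<close> at the odd
  ones. Between two odd quotients the coefficient of \<open>x\<^sup>2 / 4\<close> is then
  \<open>\<tau>\<^sub>k\<^sub>+\<^sub>1\<tau>\<^sub>k\<^sub>+\<^sub>2 - \<tau>\<^sub>k\<^sub>-\<^sub>1\<tau>\<^sub>k - 1\<close>. For four odd digits \<open>o\<^sub>1, \<dots>, o\<^sub>4\<close> between zeros this equals \<open>-2\<close> at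
  \<open>(o\<^sub>1, o\<^sub>2)\<close> if \<open>o\<^sub>2o\<^sub>3 = -1\<close>, and at \<open>(o\<^sub>3, o\<^sub>4)\<close> if \<open>o\<^sub>2o\<^sub>3 = 1\<close>, which gives the upper bound. Taking all odd
  digits equal to \<open>1\<close> attains it: along a line of grid points parallel to \<open>e\<^sub>k\<close> through a cell the product is
  concave, so no grid point does worse than the cell vertices.
\<close>

section \<open>Lattice bases from the continued fraction\<close>

locale irrational_cf =
  fixes \<alpha> :: real and a :: "nat \<Rightarrow> int"
  assumes irrational: "\<alpha> \<notin> \<rat>" and cf: "regular_cf \<alpha> a"
begin

primrec \<theta> :: "nat \<Rightarrow> real" where
  "\<theta> 0 = \<alpha> - a 0"
| "\<theta> (Suc k) = 1 / \<theta> k - a (Suc k)"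

text \<open>
  \<open>d\<close> and \<open>Q\<close> are shifted by one: \<open>Q (Suc k) = q\<^sub>k\<close> and \<open>d (Suc k) = q\<^sub>k\<alpha> - p\<^sub>k\<close>, starting from
  \<open>q\<^sub>-\<^sub>1 = 0\<close> and \<open>p\<^sub>-\<^sub>1 = 1\<close>.
\<close>

primrec d :: "nat \<Rightarrow> real" where
  "d 0 = -1"
| "d (Suc k) = - \<theta> k * d k"

fun Q :: "nat \<Rightarrow> int" where
  "Q 0 = 0"
| "Q (Suc 0) = 1"
| "Q (Suc (Suc k)) = a (Suc k) * Q (Suc k) + Q k"

definition \<phi> :: "nat \<Rightarrow> real" where
  "\<phi> k = Q k / Q (Suc k)"

text \<open>\<open>(S, T)\<close> is twice the centre of the cell, in the rescaled coordinates of level \<open>k\<close>.\<close>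

definition cell :: "real \<Rightarrow> nat \<Rightarrow> real \<Rightarrow> real \<Rightarrow> bool" where
  "cell \<gamma> k S T \<longleftrightarrow> (\<exists>n m :: int. real_of_int n = Q (Suc k) * (1 + \<phi> k + S) / 2 \<and>
     n * \<alpha> - m - \<gamma> = d k * (1 - \<theta> k + T) / 2)"

end

section \<open>Tails of regular continued fractions\<close>

lemma cf_convergent_bounds:
  assumes "\<And>i. a i \<ge> 1"
  shows "real_of_int (a 0) \<le> cf_convergent a n \<and> cf_convergent a n \<le> a 0 + 1"
  using assms
proof (induction n arbitrary: a)
  case (Suc n)
  have "real_of_int (a 1) \<le> cf_convergent (\<lambda>i. a (Suc i)) n"
    using Suc.IH[of "\<lambda>i. a (Suc i)"] Suc.prems by simp
  moreover have "real_of_int (a 1) \<ge> 1" using Suc.prems[of 1] by simp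
  ultimately show ?case by simp
qed simp

text \<open>One step of the Gauss map. The convergents of the tail are reciprocals of the shifted
  convergents minus \<open>a 0\<close>; they converge because the limit
  \<open>\<alpha> - a 0\<close> is nonzero by irrationality.\<close>

lemma regular_cf_tail:
  assumes irr: "\<alpha> \<notin> \<rat>" and cf: "regular_cf \<alpha> a"
  shows "0 < \<alpha> - a 0" "\<alpha> - a 0 < 1" "1 / (\<alpha> - a 0) \<notin> \<rat>"
    "regular_cf (1 / (\<alpha> - a 0)) (\<lambda>i. a (Suc i))"
proof -
  define \<beta> where "\<beta> = 1 / (\<alpha> - a 0)"
  have ne: "\<alpha> \<noteq> real_of_int m" for m using irr by auto
  show pos: "0 < \<alpha> - a 0" and "\<alpha> - a 0 < 1"
    using cf ne[of "a 0"] unfolding regular_cf_def by linarith+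
  have \<alpha>: "\<alpha> = a 0 + 1 / \<beta>" using pos by (simp add: \<beta>_def)
  have "\<beta> \<notin> \<rat>"
  proof
    assume "\<beta> \<in> \<rat>"
    then have "\<alpha> \<in> \<rat>" by (subst \<alpha>) auto
    with irr show False ..
  qed
  then show "1 / (\<alpha> - a 0) \<notin> \<rat>" unfolding \<beta>_def .
  have "(\<lambda>n. cf_convergent a (Suc n)) \<longlonglongrightarrow> \<alpha>"
    using cf unfolding regular_cf_def by (simp add: filterlim_sequentially_Suc del: cf_convergent.simps)
  then have "(\<lambda>n. cf_convergent a (Suc n) - a 0) \<longlonglongrightarrow> \<alpha> - a 0"
    by (intro tendsto_diff) auto
  then have "(\<lambda>n. 1 / (cf_convergent a (Suc n) - a 0)) \<longlonglongrightarrow> \<beta>"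
    unfolding \<beta>_def using pos by (intro tendsto_divide) auto
  then have lim: "cf_convergent (\<lambda>i. a (Suc i)) \<longlonglongrightarrow> \<beta>" by simp
  have ge1: "a (Suc i) \<ge> 1" for i using cf unfolding regular_cf_def by simp
  have b: "real_of_int (a 1) \<le> cf_convergent (\<lambda>i. a (Suc i)) n \<and>
      cf_convergent (\<lambda>i. a (Suc i)) n \<le> a 1 + 1" for n
    using cf_convergent_bounds[of "\<lambda>i. a (Suc i)" n] ge1 by simp
  \<comment> \<open>Limits preserve only the closed bounds \<open>a 1\<close> and
    \<open>a 1 + 1\<close>; irrationality excludes the upper one, so the floor is
    \<open>a 1\<close>.\<close>
  have "real_of_int (a 1) \<le> \<beta>" using lim b by (intro LIMSEQ_le_const) auto
  moreover have "\<beta> \<le> a 1 + 1" using lim b by (intro LIMSEQ_le_const2) auto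
  moreover have "\<beta> \<noteq> real_of_int (a 1 + 1)" using \<open>\<beta> \<notin> \<rat>\<close> by (metis Rats_of_int)
  ultimately have "a 1 = \<lfloor>\<beta>\<rfloor>" by (simp add: floor_unique)
  then show "regular_cf (1 / (\<alpha> - a 0)) (\<lambda>i. a (Suc i))"
    using lim ge1 unfolding regular_cf_def \<beta>_def by simp
qed

section \<open>Complete quotients, denominators and approximation errors\<close>

context irrational_cf begin

lemma a_ge_1: "a (Suc k) \<ge> 1"
  using cf unfolding regular_cf_def by simp

text \<open>The recursion for \<open>\<theta>\<close> is purely algebraic; carrying the complete
  quotient along identifies \<open>\<theta> k\<close> as a fractional part, which is the source of
  \<open>\<theta>_bounds\<close>.\<close>

lemma complete_quotient:
  "\<exists>\<beta>::real. \<theta> k = \<beta> - a k \<and> \<beta> \<notin> \<rat> \<and> regular_cf \<beta> (\<lambda>i. a (k + i))"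
proof (induction k)
  case 0
  then show ?case using irrational cf by (intro exI[of _ \<alpha>]) simp
next
  case (Suc k)
  then obtain \<beta> :: real where \<beta>: "\<theta> k = \<beta> - a k" "\<beta> \<notin> \<rat>" "regular_cf \<beta> (\<lambda>i. a (k + i))"
    by blast
  show ?case
    using regular_cf_tail[OF \<beta>(2,3)] \<beta>(1)
    by (intro exI[of _ "1 / (\<beta> - a k)"]) simp
qed

lemma \<theta>_bounds: "0 < \<theta> k" "\<theta> k < 1"
proof -
  obtain \<beta> :: real where \<beta>: "\<theta> k = \<beta> - a k" "\<beta> \<notin> \<rat>" "regular_cf \<beta> (\<lambda>i. a (k + i))"
    using complete_quotient by blast
  show "0 < \<theta> k" "\<theta> k < 1" using regular_cf_tail(1,2)[OF \<beta>(2,3)] \<beta>(1) by simp_all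
qed

lemma \<theta>_step: "\<theta> k * (a (Suc k) + \<theta> (Suc k)) = 1"
  using \<theta>_bounds[of k] by simp

lemma Q_nonneg: "Q k \<ge> 0 \<and> Q (Suc k) \<ge> 1"
proof (induction k)
  case (Suc k)
  have "a (Suc k) * Q (Suc k) \<ge> 1 * 1" using a_ge_1[of k] Suc by (intro mult_mono) auto
  then show ?case using Suc by auto
qed simp

lemma Q_pos: "real_of_int (Q (Suc k)) > 0"
  using Q_nonneg[of k] by simp

lemma \<phi>_bounds: "0 \<le> \<phi> k" "\<phi> k \<le> 1"
proof -
  show "0 \<le> \<phi> k" unfolding \<phi>_def using Q_nonneg[of k] by simp
  have "Q k \<le> Q (Suc k)"
  proof (cases k)
    case (Suc j)
    have "1 * Q (Suc j) \<le> a (Suc j) * Q (Suc j)"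
      using a_ge_1 Q_nonneg[of j] by (intro mult_right_mono) auto
    then show ?thesis using Suc Q_nonneg[of j] by (simp add: add_increasing2)
  qed simp
  then show "\<phi> k \<le> 1" unfolding \<phi>_def using Q_pos[of k] by simp
qed

lemma \<phi>_step: "\<phi> (Suc k) * (a (Suc k) + \<phi> k) = 1"
proof -
  have "real_of_int (Q (Suc (Suc k))) = Q (Suc k) * (a (Suc k) + \<phi> k)"
    unfolding \<phi>_def using Q_pos[of k] by (simp add: field_simps)
  then show ?thesis using Q_pos[of k] Q_pos[of "Suc k"] unfolding \<phi>_def[of "Suc k"]
    by (simp add: field_simps)
qed

lemma \<phi>_pos: "\<phi> (Suc k) > 0"
  using \<phi>_step[of k] \<phi>_bounds[of "Suc k"] by (metis less_eq_real_def mult_zero_left zero_neq_one)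

lemma Q_Suc: "real_of_int (Q (Suc k)) = \<phi> (Suc k) * Q (Suc (Suc k))"
  unfolding \<phi>_def using Q_pos[of "Suc k"] by simp

lemma Q_eq: "real_of_int (Q k) = \<phi> k * Q (Suc k)"
  unfolding \<phi>_def using Q_pos[of k] by simp

lemma d_nonzero: "d k \<noteq> 0"
  using \<theta>_bounds by (induction k) (auto simp: less_imp_neq[symmetric])

lemma d_step: "d (Suc (Suc k)) = a (Suc k) * d (Suc k) + d k"
proof -
  have "d (Suc (Suc k)) = (\<theta> k * \<theta> (Suc k)) * d k" by (simp del: \<theta>.simps)
  also have "\<theta> k * \<theta> (Suc k) = 1 - a (Suc k) * \<theta> k"
    using \<theta>_step[of k] by (simp add: algebra_simps del: \<theta>.simps)
  finally show ?thesis by (simp add: algebra_simps)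
qed

text \<open>The determinant of the basis. Since consecutive \<open>d\<close> have opposite signs, it
  reads \<open>Q (Suc k) * |d k| + Q k * |d (Suc k)| = 1\<close>, which the recursions
  preserve.\<close>

lemma area: "Q (Suc k) * \<bar>d k\<bar> * (1 + \<phi> k * \<theta> k) = 1"
proof -
  have "Q (Suc k) * \<bar>d k\<bar> + Q k * \<bar>d (Suc k)\<bar> = 1"
  proof (induction k)
    case (Suc k)
    have th: "\<theta> (Suc k) * \<theta> k = 1 - a (Suc k) * \<theta> k"
      using \<theta>_step[of k] by (simp add: algebra_simps del: \<theta>.simps)
    have d2: "\<bar>d (Suc (Suc k))\<bar> = \<theta> (Suc k) * \<theta> k * \<bar>d k\<bar>"
      using \<theta>_bounds[of k] \<theta>_bounds[of "Suc k"] by (simp add: abs_mult del: \<theta>.simps)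
    have d1: "\<bar>d (Suc k)\<bar> = \<theta> k * \<bar>d k\<bar>"
      using \<theta>_bounds[of k] by (simp add: abs_mult del: \<theta>.simps)
    from Suc show ?case unfolding d2 th unfolding d1 by (simp add: algebra_simps)
  qed simp
  moreover have "\<bar>d (Suc k)\<bar> = \<theta> k * \<bar>d k\<bar>"
    using \<theta>_bounds[of k] by (simp add: abs_mult)
  ultimately show ?thesis unfolding Q_eq[of k] by (simp add: algebra_simps)
qed

section \<open>Lattice coordinates and grid cells\<close>

lemma lattice_point:
  "\<exists>m::int. (i * Q (Suc k) + j * Q k) * \<alpha> - m = i * d (Suc k) + j * d k"
proof (induction k arbitrary: i j)
  case 0
  show ?case by (intro exI[of _ "i * a 0 + j"]) (simp add: algebra_simps)
next
  case (Suc k)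
  from Suc[of "i * a (Suc k) + j" i] obtain m :: int where
    "((i * a (Suc k) + j) * Q (Suc k) + i * Q k) * \<alpha> - m = (i * a (Suc k) + j) * d (Suc k) + i * d k"
    by (auto simp: algebra_simps simp del: d.simps)
  then show ?case
    unfolding d_step[of k] by (intro exI[of _ m]) (simp add: algebra_simps del: d.simps)
qed

text \<open>Together with \<open>lattice_point\<close> this makes the two vectors a basis of all
  points \<open>(n, n * \<alpha> - m)\<close>. The passage to the next level is unimodular:
  \<open>(i, j)\<close> becomes \<open>(j, i - j * a (Suc k))\<close>.\<close>

lemma lattice_coords:
  fixes n m :: int
  shows "\<exists>i j::int. n = i * Q (Suc k) + j * Q k \<and> n * \<alpha> - m = i * d (Suc k) + j * d k"
proof (induction k)
  case 0
  show ?case by (intro exI[of _ n] exI[of _ "m - n * a 0"]) (simp add: algebra_simps)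
next
  case (Suc k)
  then obtain i j :: int where ij: "n = i * Q (Suc k) + j * Q k"
    "n * \<alpha> - m = i * d (Suc k) + j * d k" by blast
  show ?case
  proof (intro exI conjI)
    show "n = j * Q (Suc (Suc k)) + (i - j * a (Suc k)) * Q (Suc k)"
      by (simp add: ij(1) algebra_simps)
    show "n * \<alpha> - m = j * d (Suc (Suc k)) + (i - j * a (Suc k)) * d (Suc k)"
      unfolding ij(2) d_step by (simp add: algebra_simps del: d.simps)
  qed
qed

text \<open>One vertex brings all its lattice translates into the grid. The four vertices have
  \<open>i\<close> and \<open>j\<close> in \<open>{0, -1}\<close>; \<open>cell_coords\<close> is the
  converse, that there are no other grid points.\<close>

lemma cell_point:
  fixes i j :: int and S T :: real
  assumes "cell \<gamma> k S T"
  shows "\<exists>n m::int. real_of_int n = Q (Suc k) * ((1 + 2 * i) + (1 + 2 * j) * \<phi> k + S) / 2 \<and>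
    n * \<alpha> - m - \<gamma> = d k * ((1 + 2 * j) - (1 + 2 * i) * \<theta> k + T) / 2"
proof -
  obtain n m :: int where nm: "real_of_int n = Q (Suc k) * (1 + \<phi> k + S) / 2"
    "n * \<alpha> - m - \<gamma> = d k * (1 - \<theta> k + T) / 2"
    using assms unfolding cell_def by blast
  obtain m' :: int where m': "(i * Q (Suc k) + j * Q k) * \<alpha> - m' = i * d (Suc k) + j * d k"
    using lattice_point by blast
  show ?thesis
  proof (intro exI conjI)
    show "real_of_int (n + i * Q (Suc k) + j * Q k) =
        Q (Suc k) * ((1 + 2 * i) + (1 + 2 * j) * \<phi> k + S) / 2"
      using nm(1) Q_eq[of k] by (simp add: algebra_simps add_divide_distrib)
    show "(n + i * Q (Suc k) + j * Q k) * \<alpha> - (m + m') - \<gamma> =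
        d k * ((1 + 2 * j) - (1 + 2 * i) * \<theta> k + T) / 2"
      using nm(2) m' by (simp add: algebra_simps add_divide_distrib diff_divide_distrib)
  qed
qed

lemma cell_coords:
  fixes n m :: int and S T :: real
  assumes "cell \<gamma> k S T"
  obtains i j :: int where "real_of_int n = Q (Suc k) * ((1 + 2 * i) + (1 + 2 * j) * \<phi> k + S) / 2"
    "n * \<alpha> - m - \<gamma> = d k * ((1 + 2 * j) - (1 + 2 * i) * \<theta> k + T) / 2"
proof -
  obtain n0 m0 :: int where nm: "real_of_int n0 = Q (Suc k) * (1 + \<phi> k + S) / 2"
    "n0 * \<alpha> - m0 - \<gamma> = d k * (1 - \<theta> k + T) / 2"
    using assms unfolding cell_def by blast
  obtain i j :: int where ij: "n - n0 = i * Q (Suc k) + j * Q k"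
    "real_of_int (n - n0) * \<alpha> - real_of_int (m - m0) = i * d (Suc k) + j * d k"
    using lattice_coords[where n = "n - n0" and m = "m - m0" and k = k] by blast
  have "real_of_int n = n0 + i * Q (Suc k) + j * Q k"
    using ij(1) by (metis add.assoc diff_add_cancel add.commute of_int_add of_int_mult)
  then have "real_of_int n = Q (Suc k) * ((1 + 2 * i) + (1 + 2 * j) * \<phi> k + S) / 2"
    using nm(1) Q_eq[of k] by (simp add: algebra_simps add_divide_distrib)
  moreover have "n * \<alpha> - m - \<gamma> = d k * ((1 + 2 * j) - (1 + 2 * i) * \<theta> k + T) / 2"
    using nm(2) ij(2) by (simp add: algebra_simps add_divide_distrib diff_divide_distrib)
  ultimately show ?thesis using that by blast
qed

text \<open>The 4 undoes the two halves, and \<open>area\<close> trades the scale factors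
  \<open>Q (Suc k)\<close> and \<open>d k\<close> for
  \<open>1 + \<phi> k * \<theta> k\<close>.\<close>

lemma grid_product:
  fixes n m :: int and x y \<gamma> :: real
  assumes "real_of_int n = Q (Suc k) * x / 2" "real_of_int n * \<alpha> - m - \<gamma> = d k * y / 2"
  shows "4 * (\<bar>n\<bar> * \<bar>n * \<alpha> - m - \<gamma>\<bar>) * (1 + \<phi> k * \<theta> k) = \<bar>x\<bar> * \<bar>y\<bar>"
proof -
  have "4 * (\<bar>n\<bar> * \<bar>n * \<alpha> - m - \<gamma>\<bar>) * (1 + \<phi> k * \<theta> k) =
      (Q (Suc k) * \<bar>d k\<bar> * (1 + \<phi> k * \<theta> k)) * (\<bar>x\<bar> * \<bar>y\<bar>)"
    unfolding assms(2) of_int_abs using Q_pos[of k] by (simp add: assms(1) abs_mult del: Q.simps)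
  then show ?thesis using area by simp
qed

text \<open>The next vector is \<open>e\<^sub>k\<^sub>+\<^sub>1 = a\<^sub>k\<^sub>+\<^sub>1
  e\<^sub>k + e\<^sub>k\<^sub>-\<^sub>1\<close>, and the doubled centre moves by
  \<open>\<tau> e\<^sub>k\<close>. Relative to the old centre, the new vertex has the
  \<open>e\<^sub>k\<close>-coordinate \<open>(a\<^sub>k\<^sub>+\<^sub>1 + \<tau> + 1) / 2\<close>,
  half an odd integer by the parity condition.\<close>

lemma cell_succ:
  fixes \<tau> :: int and S T S' T' :: real
  assumes "cell \<gamma> k S T" "S' = \<phi> (Suc k) * (\<tau> + S)" "T = \<theta> k * (\<tau> - T')" "even (a (Suc k) + \<tau>)"
  shows "cell \<gamma> (Suc k) S' T'"
proof -
  obtain i where i: "a (Suc k) + \<tau> = 2 * i" using assms(4) by blast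
  then have ir: "real_of_int (a (Suc k)) = 2 * i - \<tau>" by linarith
  obtain n m :: int where
    n: "real_of_int n = Q (Suc k) * ((1 + 2 * i) + (1 + 2 * (0::int)) * \<phi> k + S) / 2" and
    m: "n * \<alpha> - m - \<gamma> = d k * ((1 + 2 * (0::int)) - (1 + 2 * i) * \<theta> k + T) / 2"
    using cell_point[OF assms(1), of i 0] by blast
  have "\<phi> (Suc k) * ((1 + 2 * i) + \<phi> k + S) = 1 + \<phi> (Suc k) + S'"
    using \<phi>_step[of k] unfolding assms(2) ir by (simp add: algebra_simps)
  then have 1: "real_of_int n = Q (Suc (Suc k)) * (1 + \<phi> (Suc k) + S') / 2"
    unfolding n Q_Suc[of k] by simp
  have "(1 - (1 + 2 * i) * \<theta> k + T) = - \<theta> k * (1 - \<theta> (Suc k) + T')"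
    using \<theta>_step[of k] unfolding assms(3) ir by (simp add: algebra_simps del: \<theta>.simps)
  then have "n * \<alpha> - m - \<gamma> = d (Suc k) * (1 - \<theta> (Suc k) + T') / 2"
    unfolding m by (simp del: \<theta>.simps)
  with 1 show ?thesis unfolding cell_def by blast
qed

text \<open>A priori the centres of two consecutive cells also differ by a multiple \<open>j\<close>
  of \<open>e\<^sub>k\<^sub>-\<^sub>1\<close>; smallness of the centres rules this out and leaves
  only a digit.\<close>

lemma cell_relation:
  fixes S T S' T' :: real
  assumes "cell \<gamma> k S T" "cell \<gamma> (Suc k) S' T'"
    and small: "\<theta> k * (\<bar>S'\<bar> / \<phi> (Suc k) + \<bar>S\<bar> + \<bar>T'\<bar>) + \<bar>T\<bar> < 2"
  obtains \<tau> :: int where "S' = \<phi> (Suc k) * (\<tau> + S)" "T = \<theta> k * (\<tau> - T')" "even (a (Suc k) + \<tau>)"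
proof -
  obtain n m :: int where nm: "real_of_int n = Q (Suc (Suc k)) * (1 + \<phi> (Suc k) + S') / 2"
    "n * \<alpha> - m - \<gamma> = d (Suc k) * (1 - \<theta> (Suc k) + T') / 2"
    using assms(2) unfolding cell_def by blast
  obtain i j :: int where ij: "real_of_int n = Q (Suc k) * ((1 + 2 * i) + (1 + 2 * j) * \<phi> k + S) / 2"
    "n * \<alpha> - m - \<gamma> = d k * ((1 + 2 * j) - (1 + 2 * i) * \<theta> k + T) / 2"
    using cell_coords[OF assms(1)] by blast
  define \<tau> where "\<tau> = 2 * i - a (Suc k)"
  have "Q (Suc (Suc k)) * (1 + \<phi> (Suc k) + S') =
      Q (Suc (Suc k)) * (\<phi> (Suc k) * ((1 + 2 * i) + (1 + 2 * j) * \<phi> k + S))"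
    using nm(1) ij(1) unfolding Q_Suc[of k] by (simp only: mult_ac)
  then have "1 + \<phi> (Suc k) + S' = \<phi> (Suc k) * ((1 + 2 * i) + (1 + 2 * j) * \<phi> k + S)"
    using Q_pos[of "Suc k"] by (simp del: Q.simps)
  then have S': "S' = \<phi> (Suc k) * (\<tau> + S + 2 * j * \<phi> k)"
    using \<phi>_step[of k] by (simp add: \<tau>_def algebra_simps)
  have "d k * (- \<theta> k * (1 - \<theta> (Suc k) + T')) = d k * ((1 + 2 * j) - (1 + 2 * i) * \<theta> k + T)"
    using nm(2) ij(2) by (simp add: algebra_simps del: \<theta>.simps)
  then have "- \<theta> k * (1 - \<theta> (Suc k) + T') = (1 + 2 * j) - (1 + 2 * i) * \<theta> k + T"
    using d_nonzero[of k] by (simp only: mult_cancel_left) simp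
  then have T: "T = \<theta> k * (\<tau> - T') - 2 * j"
    using \<theta>_step[of k] by (simp add: \<tau>_def algebra_simps del: \<theta>.simps)
  have "j = 0"
  proof (rule ccontr)
    assume "j \<noteq> 0"
    then have j: "\<bar>real_of_int j\<bar> \<ge> 1" by linarith
    have \<tau>: "\<tau> = S' / \<phi> (Suc k) - S - 2 * j * \<phi> k" using S' \<phi>_pos[of k] by (simp add: field_simps)
    \<comment> \<open>Eliminating \<open>\<tau>\<close> leaves an equation for \<open>j\<close>: for
      nonzero \<open>j\<close> the left side is at least 2 in absolute value, while
      \<open>small\<close> keeps the right side below 2.\<close>
    have e: "2 * j * (1 + \<theta> k * \<phi> k) = \<theta> k * (S' / \<phi> (Suc k) - S - T') - T"
      using T unfolding \<tau> by (simp add: algebra_simps)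
    have "\<bar>S' / \<phi> (Suc k) - S - T'\<bar> \<le> \<bar>S'\<bar> / \<phi> (Suc k) + \<bar>S\<bar> + \<bar>T'\<bar>"
      using \<phi>_pos[of k] abs_divide[of S' "\<phi> (Suc k)"] by linarith
    then have "\<bar>\<theta> k * (S' / \<phi> (Suc k) - S - T')\<bar> \<le> \<theta> k * (\<bar>S'\<bar> / \<phi> (Suc k) + \<bar>S\<bar> + \<bar>T'\<bar>)"
      using \<theta>_bounds[of k] by (simp add: abs_mult)
    then have "\<bar>2 * j * (1 + \<theta> k * \<phi> k)\<bar> < 2" using small e by linarith
    moreover have "\<bar>2 * j * (1 + \<theta> k * \<phi> k)\<bar> \<ge> 2 * 1"
      unfolding abs_mult using j \<theta>_bounds[of k] \<phi>_bounds[of k] by (intro mult_mono) auto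
    ultimately show False by simp
  qed
  then show ?thesis using that[of \<tau>] S' T by (simp add: \<tau>_def)
qed

lemma cell_exists:
  obtains \<xi> \<eta> :: real where "\<bar>\<xi>\<bar> \<le> 1" "\<bar>\<eta>\<bar> \<le> 1" "cell \<gamma> k (\<xi> + \<eta> * \<phi> k) (\<eta> - \<xi> * \<theta> k)"
proof -
  have nz: "1 + \<phi> k * \<theta> k > 0"
    using \<theta>_bounds[of k] \<phi>_bounds[of k] by (simp add: add_pos_nonneg)
  \<comment> \<open>\<open>u\<close> and \<open>v\<close> are the coordinates of
    \<open>(0, - \<gamma>)\<close> along \<open>e\<^sub>k\<close> and
    \<open>e\<^sub>k\<^sub>-\<^sub>1\<close>. Subtracting their floors gives a grid point with both
    coordinates in \<open>[0, 1)\<close>, which is taken as the vertex with coordinates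
    \<open>(1 + \<xi>) / 2\<close> and \<open>(1 + \<eta>) / 2\<close>.\<close>
  define v where "v = - \<gamma> / (d k * (1 + \<phi> k * \<theta> k))"
  define u where "u = - v * \<phi> k"
  define i j where "i = - \<lfloor>u\<rfloor>" and "j = - \<lfloor>v\<rfloor>"
  define \<xi> \<eta> where "\<xi> = 2 * (u + i) - 1" and "\<eta> = 2 * (v + j) - 1"
  have "\<bar>\<xi>\<bar> \<le> 1" "\<bar>\<eta>\<bar> \<le> 1" unfolding \<xi>_def \<eta>_def i_def j_def by (simp; linarith)+
  have v: "- \<gamma> = d k * (v - u * \<theta> k)"
  proof -
    have "v - u * \<theta> k = v * (1 + \<phi> k * \<theta> k)" unfolding u_def by (simp add: algebra_simps)
    then show ?thesis using nz d_nonzero[of k] unfolding v_def by simp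
  qed
  obtain m :: int where m: "(i * Q (Suc k) + j * Q k) * \<alpha> - m = i * d (Suc k) + j * d k"
    using lattice_point by blast
  have "cell \<gamma> k (\<xi> + \<eta> * \<phi> k) (\<eta> - \<xi> * \<theta> k)"
    unfolding cell_def
  proof (intro exI conjI)
    show "real_of_int (i * Q (Suc k) + j * Q k) = Q (Suc k) * (1 + \<phi> k + (\<xi> + \<eta> * \<phi> k)) / 2"
      using Q_eq[of k] unfolding \<xi>_def \<eta>_def u_def by (simp add: algebra_simps)
    have "(i * Q (Suc k) + j * Q k) * \<alpha> - m - \<gamma> = i * d (Suc k) + j * d k + d k * (v - u * \<theta> k)"
      using m v by simp
    then show "(i * Q (Suc k) + j * Q k) * \<alpha> - m - \<gamma> = d k * (1 - \<theta> k + (\<eta> - \<xi> * \<theta> k)) / 2"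
      unfolding \<xi>_def \<eta>_def by (simp add: algebra_simps)
  qed
  then show ?thesis using that \<open>\<bar>\<xi>\<bar> \<le> 1\<close> \<open>\<bar>\<eta>\<bar> \<le> 1\<close> by blast
qed

end

section \<open>Grid points and the approximation constant\<close>

lemma dist_int_le: "dist_int x \<le> \<bar>x - of_int m\<bar>"
  unfolding dist_int_def using infdist_le[of "of_int m" \<int> x] by (simp add: dist_real_def)

lemma dist_int_geI:
  assumes "\<And>m::int. b \<le> \<bar>x - of_int m\<bar>"
  shows "b \<le> dist_int x"
proof -
  have "b \<le> (INF z\<in>\<int>. dist x z)"
    using assms by (intro cINF_greatest) (auto simp: dist_real_def elim!: Ints_cases)
  then show ?thesis unfolding dist_int_def by (subst infdist_notempty) auto
qed

lemma dist_int_pos: "x \<notin> \<int> \<Longrightarrow> 0 < dist_int x"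
  unfolding dist_int_def by (rule infdist_pos_not_in_closed) auto

lemma approx_const_geI:
  fixes N :: int and b \<alpha> \<gamma> :: real
  assumes "\<And>n m :: int. N \<le> \<bar>n\<bar> \<Longrightarrow> b \<le> \<bar>n\<bar> * \<bar>n * \<alpha> - m - \<gamma>\<bar>"
  shows "ereal b \<le> approx_const \<alpha> \<gamma>"
  unfolding approx_const_def
proof (rule Liminf_bounded, unfold eventually_filtercomap_at_top_linorder, intro exI allI impI)
  fix n :: int assume n: "max N 1 \<le> \<bar>n\<bar>"
  then have pos: "0 < \<bar>real_of_int n\<bar>" by auto
  have "b / \<bar>real_of_int n\<bar> \<le> dist_int (n * \<alpha> - \<gamma>)"
  proof (rule dist_int_geI)
    fix m :: int
    have "b \<le> \<bar>n\<bar> * \<bar>n * \<alpha> - m - \<gamma>\<bar>" using assms n by auto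
    then show "b / \<bar>real_of_int n\<bar> \<le> \<bar>n * \<alpha> - \<gamma> - m\<bar>"
      using pos by (simp add: divide_le_eq mult.commute algebra_simps)
  qed
  then show "ereal b \<le> ereal (\<bar>real_of_int n\<bar> * dist_int (n * \<alpha> - \<gamma>))"
    using pos by (simp add: divide_le_eq mult.commute)
qed

section \<open>From the lower limit to grid points close to the horizontal axis\<close>

context irrational_cf begin

text \<open>A single factor \<open>\<theta> k\<close> may be close to 1, but the product of two
  consecutive ones is at most \<open>1 / 2\<close>: it is below \<open>\<theta> k\<close>, and its
  sum with \<open>\<theta> k\<close> is at most 1.\<close>

lemma d_bound: "\<bar>d (2 * k)\<bar> \<le> (1 / 2) ^ k"
proof (induction k)
  case (Suc k)
  let ?k = "2 * k"
  have "\<theta> ?k * (1 + \<theta> (Suc ?k)) \<le> \<theta> ?k * (a (Suc ?k) + \<theta> (Suc ?k))"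
    using a_ge_1[of ?k] \<theta>_bounds(1)[of ?k] by (intro mult_left_mono) auto
  then have "\<theta> ?k * (1 + \<theta> (Suc ?k)) \<le> 1" using \<theta>_step[of ?k] by linarith
  moreover have "\<theta> ?k * \<theta> (Suc ?k) < \<theta> ?k * 1"
    using \<theta>_bounds(1)[of ?k] \<theta>_bounds(2)[of "Suc ?k"] by (intro mult_strict_left_mono)
  ultimately have "\<theta> ?k * \<theta> (Suc ?k) \<le> 1 / 2" by (simp add: algebra_simps del: \<theta>.simps)
  moreover have "\<bar>d (2 * Suc k)\<bar> = \<theta> ?k * \<theta> (Suc ?k) * \<bar>d ?k\<bar>"
    using \<theta>_bounds(1)[of ?k] \<theta>_bounds(1)[of "Suc ?k"] by (simp add: abs_mult del: \<theta>.simps)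
  moreover have "\<theta> ?k * \<theta> (Suc ?k) * \<bar>d ?k\<bar> \<le> 1 / 2 * (1 / 2) ^ k"
    using Suc calculation(1) by (intro mult_mono) auto
  ultimately show ?case by simp
qed simp

lemma d_antimono: "j \<le> k \<Longrightarrow> \<bar>d k\<bar> \<le> \<bar>d j\<bar>"
proof (induction k rule: dec_induct)
  case (step k)
  have "\<bar>d (Suc k)\<bar> \<le> 1 * \<bar>d k\<bar>" 
    using \<theta>_bounds[of k] by (simp add: abs_mult mult_left_le_one_le)
  then show ?case using step by simp
qed simp

lemma d_small:
  assumes "0 < e"
  obtains K where "\<And>k. K \<le> k \<Longrightarrow> \<bar>d k\<bar> < e"
proof -
  obtain r where "(1 / 2 :: real) ^ r < e" using real_arch_pow_inv[OF assms, of "1/2"] by auto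
  then have "\<bar>d k\<bar> < e" if "2 * r \<le> k" for k
    using d_antimono[OF that] d_bound[of r] by linarith
  then show ?thesis using that by blast
qed

lemma Q_ge: "int k \<le> Q (Suc (Suc k)) \<and> int k \<le> Q (Suc k) + 1"
proof (induction k)
  case (Suc k)
  have "1 * Q (Suc (Suc k)) \<le> a (Suc (Suc k)) * Q (Suc (Suc k))"
    using a_ge_1[of "Suc k"] Q_nonneg[of "Suc k"] by (intro mult_right_mono) auto
  moreover have "Q (Suc k) \<ge> 1" using Q_nonneg[of k] by simp
  moreover have "Q (Suc (Suc (Suc k))) = a (Suc (Suc k)) * Q (Suc (Suc k)) + Q (Suc k)" by simp
  ultimately show ?case using Suc by linarith
qed (use Q_nonneg[of 1] in auto)

text \<open>The lower limit controls only large \<open>|n|\<close>. As \<gamma> lies outside the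
  excluded set, the finitely many small \<open>n\<close> keep a positive distance from the axis, so
  a small second coordinate forces \<open>|n|\<close> to be large. This trades a condition on
  \<open>n\<close> for one on the level.\<close>

lemma grid_eventually_large:
  assumes \<gamma>: "\<gamma> \<notin> {real_of_int m + real_of_int k * \<alpha> | m k. True}"
    and b: "ereal b < approx_const \<alpha> \<gamma>"
  obtains K where "\<And>k n m. K \<le> k \<Longrightarrow> \<bar>real_of_int n * \<alpha> - of_int m - \<gamma>\<bar> \<le> 2 * \<bar>d k\<bar> \<Longrightarrow>
    b < \<bar>of_int n\<bar> * \<bar>of_int n * \<alpha> - of_int m - \<gamma>\<bar>"
proof -
  have "eventually (\<lambda>n. ereal b < ereal (\<bar>real_of_int n\<bar> * dist_int (n * \<alpha> - \<gamma>)))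
      (filtercomap (\<lambda>n::int. \<bar>n\<bar>) at_top)"
    using b unfolding approx_const_def by (rule less_LiminfD)
  then obtain N :: int where N: "\<And>n. N \<le> \<bar>n\<bar> \<Longrightarrow> b < \<bar>real_of_int n\<bar> * dist_int (n * \<alpha> - \<gamma>)"
    unfolding eventually_filtercomap_at_top_linorder by auto
  \<comment> \<open>The extra 1 keeps the set nonempty even when \<open>N\<close> is
    negative.\<close>
  define A where "A = insert 1 ((\<lambda>n::int. dist_int (n * \<alpha> - \<gamma>)) ` {-N..N})"
  have fin: "finite A" "A \<noteq> {}" unfolding A_def by auto
  have "0 < dist_int (real_of_int n * \<alpha> - \<gamma>)" for n
  proof (rule dist_int_pos)
    show "real_of_int n * \<alpha> - \<gamma> \<notin> \<int>"
    proof
      assume "real_of_int n * \<alpha> - \<gamma> \<in> \<int>"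
      then obtain m :: int where "real_of_int n * \<alpha> - \<gamma> = m" by (rule Ints_cases)
      then have "\<gamma> = real_of_int (- m) + real_of_int n * \<alpha>" by simp
      with \<gamma> show False by blast
    qed
  qed
  then have "0 < Min A" using fin unfolding A_def by (subst Min_gr_iff) auto
  then obtain K where K: "\<And>k. K \<le> k \<Longrightarrow> \<bar>d k\<bar> < Min A / 2" using d_small[of "Min A / 2"] by auto
  show ?thesis
  proof (rule that)
    fix k and n m :: int
    assume "K \<le> k" and y: "\<bar>real_of_int n * \<alpha> - of_int m - \<gamma>\<bar> \<le> 2 * \<bar>d k\<bar>"
    have le: "dist_int (n * \<alpha> - \<gamma>) \<le> \<bar>n * \<alpha> - m - \<gamma>\<bar>"
      using dist_int_le[of "n * \<alpha> - \<gamma>" m] by (simp add: algebra_simps)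
    then have "dist_int (n * \<alpha> - \<gamma>) < Min A" using y K[OF \<open>K \<le> k\<close>] by linarith
    then have "dist_int (n * \<alpha> - \<gamma>) \<notin> A" using Min_le[OF fin(1)] by force
    then have "N \<le> \<bar>n\<bar>" unfolding A_def by force
    then have "b < \<bar>real_of_int n\<bar> * dist_int (n * \<alpha> - \<gamma>)" by (rule N)
    also have "\<dots> \<le> \<bar>real_of_int n\<bar> * \<bar>n * \<alpha> - m - \<gamma>\<bar>" using le by (intro mult_left_mono) auto
    finally show "b < \<bar>of_int n\<bar> * \<bar>of_int n * \<alpha> - of_int m - \<gamma>\<bar>" .
  qed
qed

lemma cell_vertices_large:
  fixes S T :: real and i j :: int
  assumes cell: "cell \<gamma> k S T"
    and large: "\<And>n m. \<bar>real_of_int n * \<alpha> - of_int m - \<gamma>\<bar> \<le> 2 * \<bar>d k\<bar> \<Longrightarrow>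
      b < \<bar>of_int n\<bar> * \<bar>of_int n * \<alpha> - of_int m - \<gamma>\<bar>"
    and ij: "\<bar>(1 + 2 * j) - (1 + 2 * i) * \<theta> k + T\<bar> \<le> 4"
  shows "4 * b * (1 + \<phi> k * \<theta> k)
    < \<bar>(1 + 2 * i) + (1 + 2 * j) * \<phi> k + S\<bar> * \<bar>(1 + 2 * j) - (1 + 2 * i) * \<theta> k + T\<bar>"
proof -
  obtain n m :: int where nm: "real_of_int n = Q (Suc k) * ((1 + 2 * i) + (1 + 2 * j) * \<phi> k + S) / 2"
    "n * \<alpha> - m - \<gamma> = d k * ((1 + 2 * j) - (1 + 2 * i) * \<theta> k + T) / 2"
    using cell_point[OF cell] by blast
  have "\<bar>n * \<alpha> - m - \<gamma>\<bar> \<le> 2 * \<bar>d k\<bar>"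
    unfolding nm(2) using mult_left_mono[OF ij, of "\<bar>d k\<bar>"] by (simp add: abs_mult)
  then have "b < \<bar>n\<bar> * \<bar>n * \<alpha> - m - \<gamma>\<bar>" using large by simp
  then have "4 * b * (1 + \<phi> k * \<theta> k) < 4 * (\<bar>n\<bar> * \<bar>n * \<alpha> - m - \<gamma>\<bar>) * (1 + \<phi> k * \<theta> k)"
    using \<theta>_bounds[of k] \<phi>_bounds[of k] by (intro mult_strict_right_mono) (auto simp: add_pos_nonneg)
  then show ?thesis unfolding grid_product[OF nm] .
qed

text \<open>A crude bound for the case of small \<open>R\<close>. One vertex suffices: its rescaled
  coordinates are at most 4 and 2 in absolute value, but their product would have to exceed
  8.\<close>

lemma approx_const_le_2:
  assumes \<gamma>: "\<gamma> \<notin> {real_of_int m + real_of_int k * \<alpha> | m k. True}"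
  shows "approx_const \<alpha> \<gamma> \<le> ereal 2"
proof (rule ccontr)
  assume "\<not> ?thesis"
  then have "ereal 2 < approx_const \<alpha> \<gamma>" by simp
  from grid_eventually_large[OF \<gamma> this] obtain K where
    K: "\<And>k n m. K \<le> k \<Longrightarrow> \<bar>real_of_int n * \<alpha> - of_int m - \<gamma>\<bar> \<le> 2 * \<bar>d k\<bar> \<Longrightarrow>
    2 < \<bar>of_int n\<bar> * \<bar>of_int n * \<alpha> - of_int m - \<gamma>\<bar>" by blast
  obtain \<xi> \<eta> :: real where c: "\<bar>\<xi>\<bar> \<le> 1" "\<bar>\<eta>\<bar> \<le> 1" "cell \<gamma> K (\<xi> + \<eta> * \<phi> K) (\<eta> - \<xi> * \<theta> K)"
    by (rule cell_exists)
  define A B where "A = 1 + \<xi>" and "B = 1 + \<eta>"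
  have AB: "0 \<le> A" "A \<le> 2" "0 \<le> B" "B \<le> 2" using c unfolding A_def B_def by auto
  note t = \<theta>_bounds[of K] and p = \<phi>_bounds[of K]
  have "0 \<le> A * \<theta> K" "A * \<theta> K \<le> 2 * 1" using AB t by (simp, intro mult_mono) auto
  then have y: "\<bar>B - A * \<theta> K\<bar> \<le> 2" using AB by linarith
  have "0 \<le> B * \<phi> K" "B * \<phi> K \<le> 2 * 1" using AB p by (simp, intro mult_mono) auto
  then have x: "\<bar>A + B * \<phi> K\<bar> \<le> 4" using AB by linarith
  have "4 * 2 * (1 + \<phi> K * \<theta> K) < \<bar>A + B * \<phi> K\<bar> * \<bar>B - A * \<theta> K\<bar>"
    using cell_vertices_large[OF c(3) K[OF order_refl], where i = 0 and j = 0] y unfolding A_def B_def by (simp add: algebra_simps)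
  also have "\<bar>A + B * \<phi> K\<bar> * \<bar>B - A * \<theta> K\<bar> \<le> 4 * 2" using x y by (intro mult_mono) auto
  finally have "\<phi> K * \<theta> K < 0" by simp
  moreover have "0 \<le> \<phi> K * \<theta> K" using t p by simp
  ultimately show False by linarith
qed

end

section \<open>Lower bounds from a sequence of cells\<close>

text \<open>
  The points are those with \<open>e\<^sub>k\<^sub>-\<^sub>1\<close>-coordinate \<open>1/2\<close>. Where the second coordinate changes sign, the two
  neighbouring points are vertices of the cell at the next level.
\<close>

lemma cell_line_bound:
  fixes \<phi> \<theta> \<phi>' \<theta>' S T S' T' a \<tau> I B :: real
  assumes "0 \<le> \<phi>" "0 < \<theta>" "0 < \<phi>'" "0 \<le> \<theta>'"
    and \<theta>: "\<theta> * (a + \<theta>') = 1" and \<phi>: "\<phi>' * (a + \<phi>) = 1"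
    and S': "S' = \<phi>' * (\<tau> + S)" and T: "T = \<theta> * (\<tau> - T')"
    and small: "\<phi> + \<bar>S\<bar> < 1" "\<bar>T\<bar> < 1" "\<phi>' + \<bar>S'\<bar> < 1" "\<theta>' + \<bar>T'\<bar> < 1"
    and v: "B * (1 + \<phi> * \<theta>) \<le> (1 - \<phi> - S) * (1 + \<theta> + T)"
      "B * (1 + \<phi> * \<theta>) \<le> (1 + \<phi> + S) * (1 - \<theta> + T)"
    and w: "B * (1 + \<phi>' * \<theta>') \<le> (1 - \<phi>' + S') * (1 + \<theta>' - T')"
      "B * (1 + \<phi>' * \<theta>') \<le> (1 + \<phi>' + S') * (1 - \<theta>' + T')"
    and I: "I \<le> -1 \<or> 1 \<le> I \<and> I \<le> a + \<tau> - 1 \<or> 1 \<le> I \<and> a + \<tau> + 1 \<le> I"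
  shows "B * (1 + \<phi> * \<theta>) \<le> \<bar>I + \<phi> + S\<bar> * \<bar>1 - I * \<theta> + T\<bar>"
proof -
  \<comment> \<open>The levels are normalised by \<open>1 + \<phi> * \<theta>\<close> and
    \<open>1 + \<phi>' * \<theta>'\<close>; this identity lets vertex bounds of the next level be
    read in the coordinates of the present one.\<close>
  have scale: "\<phi>' * (1 + \<phi> * \<theta>) = \<theta> * (1 + \<phi>' * \<theta>')"
    using \<theta> \<phi> by algebra
  have next_level: "B * (1 + \<phi> * \<theta>) \<le> x * y" if "B * (1 + \<phi>' * \<theta>') \<le> x' * y'"
    "x' = \<phi>' * x" "y = \<theta> * y'" for x y x' y' :: real
  proof -
    have "\<phi>' * (B * (1 + \<phi> * \<theta>)) = \<theta> * (B * (1 + \<phi>' * \<theta>'))" using scale by algebra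
    also have "\<dots> \<le> \<theta> * (x' * y')" using that(1) \<open>0 < \<theta>\<close> by simp
    also have "\<dots> = \<phi>' * (x * y)" using that(2,3) by simp
    finally show ?thesis using \<open>0 < \<phi>'\<close> by simp
  qed
  consider "I \<le> -1" | "1 \<le> I" "I \<le> a + \<tau> - 1" | "1 \<le> I" "a + \<tau> + 1 \<le> I" using I by blast
  then show ?thesis
  proof cases
    case 1
    have "I * \<theta> \<le> -1 * \<theta>" using 1 \<open>0 < \<theta>\<close> by (intro mult_right_mono) auto
    then have "(1 - \<phi> - S) * (1 + \<theta> + T) \<le> \<bar>I + \<phi> + S\<bar> * \<bar>1 - I * \<theta> + T\<bar>"
      using small 1 \<open>0 < \<theta>\<close> by (intro mult_mono) linarith+
    then show ?thesis using v by linarith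
  next
    case 2
    \<comment> \<open>The points 1 and \<open>?J\<close> are vertices of the present and of the next
      cell. Between them the product \<open>f\<close> is a concave quadratic: a value below both
      ends would put \<open>g\<close> below \<open>\<theta> * (I + 1)\<close> and above
      \<open>\<theta> * (I + ?J)\<close>.\<close>
    let ?J = "a + \<tau> - 1"
    define f where "f t = (t + (\<phi> + S)) * (1 + T - t * \<theta>)" for t
    have f1: "B * (1 + \<phi> * \<theta>) \<le> f 1" using v(2) by (simp add: f_def algebra_simps)
    have "B * (1 + \<phi> * \<theta>) \<le> f ?J" unfolding f_def
    proof (rule next_level[OF w(1)])
      show "1 - \<phi>' + S' = \<phi>' * (?J + (\<phi> + S))" using \<phi> unfolding S' by algebra
      show "1 + T - ?J * \<theta> = \<theta> * (1 + \<theta>' - T')" using \<theta> unfolding T by algebra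
    qed
    moreover have "f 1 \<le> f I \<or> f ?J \<le> f I"
    proof (rule ccontr)
      assume "\<not> ?thesis"
      then have lt: "f I < f 1" "f I < f ?J" by auto
      define g where "g = 1 + T - \<theta> * (\<phi> + S)"
      have "f I - f 1 = (I - 1) * (g - \<theta> * (I + 1))" unfolding f_def g_def by algebra
      then have "(I - 1) * (g - \<theta> * (I + 1)) < 0" using lt by simp
      then have 1: "g < \<theta> * (I + 1)" using 2(1) by (simp add: mult_less_0_iff)
      have "f I - f ?J = (?J - I) * (\<theta> * (I + ?J) - g)" unfolding f_def g_def by algebra
      then have "(?J - I) * (\<theta> * (I + ?J) - g) < 0" using lt by simp
      then have "\<theta> * (I + ?J) < g" using 2(2) by (simp add: mult_less_0_iff)
      with 1 have "\<theta> * (I + ?J) < \<theta> * (I + 1)" by linarith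
      then show False using \<open>0 < \<theta>\<close> 2 by simp
    qed
    ultimately have "B * (1 + \<phi> * \<theta>) \<le> f I" using f1 by linarith
    also have "\<dots> \<le> \<bar>f I\<bar>" by simp
    also have "\<dots> = \<bar>I + \<phi> + S\<bar> * \<bar>1 - I * \<theta> + T\<bar>" unfolding f_def abs_mult by (simp add: algebra_simps)
    finally show ?thesis .
  next
    case 3
    \<comment> \<open>Past the sign change \<open>?J\<close> is again a vertex of the next cell, and
      from there on both factors grow in absolute value.\<close>
    let ?J = "a + \<tau> + 1"
    have J: "1 + \<phi>' + S' = \<phi>' * (?J + \<phi> + S)" using \<phi> unfolding S' by algebra
    have y: "?J * \<theta> - 1 - T = \<theta> * (1 - \<theta>' + T')" using \<theta> unfolding T by algebra
    have "B * (1 + \<phi> * \<theta>) \<le> (?J + \<phi> + S) * (?J * \<theta> - 1 - T)"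
      using next_level[OF w(2) J y] .
    also have "\<dots> \<le> \<bar>I + \<phi> + S\<bar> * \<bar>1 - I * \<theta> + T\<bar>"
    proof (rule mult_mono)
      show "?J + \<phi> + S \<le> \<bar>I + \<phi> + S\<bar>" using 3 by linarith
      have "?J * \<theta> \<le> I * \<theta>" using 3 \<open>0 < \<theta>\<close> by (intro mult_right_mono) auto
      then show "?J * \<theta> - 1 - T \<le> \<bar>1 - I * \<theta> + T\<bar>" by linarith
      show "0 \<le> ?J * \<theta> - 1 - T" unfolding y using small \<open>0 < \<theta>\<close> by simp
    qed simp
    finally show ?thesis .
  qed
qed

section \<open>Grids with prescribed digits\<close>

context irrational_cf begin

text \<open>The recursion expresses \<open>T k\<close> by \<open>T (Suc k)\<close>, so it is solved
  from infinity. Multiplied by \<open>- d k\<close> it unrolls into the series \<open>t\<close>,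
  whose terms decay geometrically because the quotients are at least 2.\<close>

lemma bounded_tail_exists:
  fixes \<tau> :: "nat \<Rightarrow> int"
  assumes a2: "\<And>k. N \<le> k \<Longrightarrow> 2 \<le> a (Suc k)" and \<tau>: "\<And>k. \<bar>\<tau> k\<bar> \<le> 1"
  obtains T :: "nat \<Rightarrow> real" where "\<forall>k\<ge>N. T k = \<theta> k * (\<tau> (Suc k) - T (Suc k))"
    "\<forall>k\<ge>N. \<bar>T k\<bar> \<le> 1"
proof -
  have half: "\<theta> k \<le> 1 / 2" if "N \<le> k" for k
  proof -
    have "\<theta> k * 2 \<le> \<theta> k * (a (Suc k) + \<theta> (Suc k))"
      using a2[OF that] \<theta>_bounds(1)[of k] \<theta>_bounds(1)[of "Suc k"]
      by (intro mult_left_mono) linarith+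
    then show ?thesis using \<theta>_step[of k] by linarith
  qed
  have geo: "\<bar>d (k + i)\<bar> \<le> \<bar>d k\<bar> * (1 / 2) ^ i" if "N \<le> k" for k i
  proof (induction i)
    case (Suc i)
    have "\<bar>d (k + Suc i)\<bar> = \<theta> (k + i) * \<bar>d (k + i)\<bar>"
      using \<theta>_bounds(1)[of "k + i"] by (simp add: abs_mult)
    also have "\<dots> \<le> 1 / 2 * (\<bar>d k\<bar> * (1 / 2) ^ i)"
      using half[of "k + i"] that Suc by (intro mult_mono) auto
    finally show ?case by simp
  qed simp
  define t where "t k = (\<Sum>i. \<tau> (Suc (k + i)) * d (Suc (k + i)))" for k
  have bound: "norm (\<tau> (Suc (k + i)) * d (Suc (k + i))) \<le> \<bar>d (Suc k)\<bar> * (1 / 2) ^ i"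
    if "N \<le> k" for k i
  proof -
    have "\<bar>real_of_int (\<tau> (Suc (k + i)))\<bar> \<le> 1" using \<tau>[of "Suc (k + i)"] by linarith
    then have "norm (\<tau> (Suc (k + i)) * d (Suc (k + i))) \<le> 1 * \<bar>d (Suc (k + i))\<bar>"
      unfolding real_norm_def abs_mult by (intro mult_right_mono) auto
    then show ?thesis using geo[of "Suc k" i] that by simp
  qed
  have sg: "summable (\<lambda>i. \<bar>d (Suc k)\<bar> * (1 / 2) ^ i)" for k
    by (intro summable_mult summable_geometric) auto
  have sum: "summable (\<lambda>i. \<tau> (Suc (k + i)) * d (Suc (k + i)))" if "N \<le> k" for k
    using bound[OF that] by (intro summable_comparison_test[OF _ sg[of k]]) auto
  have t_step: "t k = \<tau> (Suc k) * d (Suc k) + t (Suc k)" if "N \<le> k" for k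
    using suminf_split_head[OF sum[OF that]] unfolding t_def by simp
  have t_bound: "\<bar>t k\<bar> \<le> \<bar>d k\<bar>" if "N \<le> k" for k
  proof -
    have "\<bar>t k\<bar> \<le> (\<Sum>i. \<bar>d (Suc k)\<bar> * (1 / 2) ^ i)"
      unfolding t_def using norm_suminf_le[OF bound[OF that] sg[of k]] by simp
    also have "\<dots> = \<bar>d (Suc k)\<bar> * 2"
      by (subst suminf_mult) (auto simp: suminf_geometric summable_geometric)
    also have "\<dots> = 2 * \<theta> k * \<bar>d k\<bar>" using \<theta>_bounds(1)[of k] by (simp add: abs_mult)
    also have "\<dots> \<le> 1 * \<bar>d k\<bar>" using half[OF that] by (intro mult_right_mono) auto
    finally show ?thesis by simp
  qed
  show ?thesis
  proof (rule that[of "\<lambda>k. - t k / d k"]; intro allI impI)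
    fix k assume "N \<le> k"
    show "- t k / d k = \<theta> k * (\<tau> (Suc k) - - t (Suc k) / d (Suc k))"
      unfolding t_step[OF \<open>N \<le> k\<close>] using d_nonzero[of k] \<theta>_bounds(1)[of k]
      by (simp add: field_simps)
    show "\<bar>- t k / d k\<bar> \<le> 1"
      using t_bound[OF \<open>N \<le> k\<close>] d_nonzero[of k] by (simp add: abs_divide divide_le_eq)
  qed
qed

lemma cell_sequence_exists:
  fixes \<tau> :: "nat \<Rightarrow> int" and T :: "nat \<Rightarrow> real"
  assumes T: "\<And>k. N \<le> k \<Longrightarrow> T k = \<theta> k * (\<tau> (Suc k) - T (Suc k))"
    and parity: "\<And>k. even (a (Suc k) + \<tau> (Suc k))"
  obtains \<gamma> :: real and S :: "nat \<Rightarrow> real" where "S N = 1 - \<phi> N" "\<forall>k\<ge>N. S (Suc k) = \<phi> (Suc k) * (\<tau> (Suc k) + S k)"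
    "\<forall>k\<ge>N. cell \<gamma> k (S k) (T k)"
proof -
  \<comment> \<open>The start \<open>1 - \<phi> N\<close> turns the first coordinate
    \<open>Q (Suc N) * (1 + \<phi> N + S N) / 2\<close> into the integer \<open>Q (Suc N)\<close>;
    with \<open>m = 0\<close> the prescribed \<open>T N\<close> then fixes \<gamma>.\<close>
  define s where "s = rec_nat (1 - \<phi> N) (\<lambda>j s. \<phi> (Suc (N + j)) * (\<tau> (Suc (N + j)) + s))"
  define S where "S k = s (k - N)" for k
  define \<gamma> where "\<gamma> = Q (Suc N) * \<alpha> - d N * (1 - \<theta> N + T N) / 2"
  have S0: "S N = 1 - \<phi> N" unfolding S_def s_def by simp
  have S: "S (Suc k) = \<phi> (Suc k) * (\<tau> (Suc k) + S k)" if "N \<le> k" for k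
    using that unfolding S_def s_def by (simp add: Suc_diff_le)
  have "cell \<gamma> k (S k) (T k)" if "N \<le> k" for k
    using that
  proof (induction k rule: dec_induct)
    case base
    show ?case unfolding cell_def S0 \<gamma>_def by (intro exI[of _ "Q (Suc N)"] exI[of _ 0]) simp
  next
    case (step k)
    show ?case using cell_succ[OF step.IH S[OF step.hyps(1)] T[OF step.hyps(1)] parity] .
  qed
  with S0 S show ?thesis using that by blast
qed

text \<open>Each \<open>n\<close> is treated at the level where \<open>|n|\<close> passes a fixed
  multiple of the denominator. There \<open>cell_line_bound\<close> covers the two lines with
  \<open>|J| = 1\<close>, and on all other lines both coordinates are large enough by
  themselves.\<close>

lemma cell_sequence_lower:
  fixes \<tau> :: "nat \<Rightarrow> int" and S T :: "nat \<Rightarrow> real" and B :: real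
  assumes cell: "\<And>k. N \<le> k \<Longrightarrow> cell \<gamma> k (S k) (T k)"
    and S: "\<And>k. N \<le> k \<Longrightarrow> S (Suc k) = \<phi> (Suc k) * (\<tau> (Suc k) + S k)"
    and T: "\<And>k. N \<le> k \<Longrightarrow> T k = \<theta> k * (\<tau> (Suc k) - T (Suc k))"
    and parity: "\<And>k. even (a (Suc k) + \<tau> (Suc k))"
    and small: "\<And>k. N \<le> k \<Longrightarrow> \<bar>S k\<bar> \<le> 1 / 10" "\<And>k. N \<le> k \<Longrightarrow> \<bar>T k\<bar> \<le> 1 / 10"
      "\<And>k. N \<le> k \<Longrightarrow> \<phi> k \<le> 1 / 10" "\<And>k. N \<le> k \<Longrightarrow> \<theta> k \<le> 1 / 10"
    and B: "B \<le> 1"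
    and v1: "\<And>k. N \<le> k \<Longrightarrow> B * (1 + \<phi> k * \<theta> k) \<le> (1 + \<phi> k + S k) * (1 - \<theta> k + T k)"
    and v2: "\<And>k. N \<le> k \<Longrightarrow> B * (1 + \<phi> k * \<theta> k) \<le> (1 - \<phi> k - S k) * (1 + \<theta> k + T k)"
    and v3: "\<And>k. N \<le> k \<Longrightarrow> B * (1 + \<phi> k * \<theta> k) \<le> (1 - \<phi> k + S k) * (1 + \<theta> k - T k)"
    and v4: "\<And>k. N \<le> k \<Longrightarrow> B * (1 + \<phi> k * \<theta> k) \<le> (1 + \<phi> k - S k) * (1 - \<theta> k - T k)"
  shows "\<gamma> \<notin> {real_of_int m + real_of_int k * \<alpha> | m k. True}"
    and "ereal (B / 4) \<le> approx_const \<alpha> \<gamma>"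
proof -
  have \<phi>\<theta>: "0 \<le> \<phi> k * \<theta> k" "\<phi> k * \<theta> k \<le> 1 / 100" if "N \<le> k" for k
    using small(3,4)[OF that] \<phi>_bounds[of k] \<theta>_bounds[of k] mult_mono[of "\<phi> k" "1/10" "\<theta> k" "1/10"]
    by auto
  have Q_unbounded: "\<exists>k\<ge>N. c < Q (Suc k)" for c :: real
  proof -
    define k where "k = Suc (max N (nat \<lceil>c\<rceil> + 2))"
    have "real_of_int (int (k - 1)) \<le> Q (Suc k)"
      using Q_ge[of "k - 1"] unfolding k_def by (simp del: Q.simps)
    moreover have "c < real_of_int (int (k - 1))" unfolding k_def by simp linarith
    ultimately show ?thesis unfolding k_def by (intro exI[of _ k]) (auto simp: k_def simp del: Q.simps)
  qed
  show "\<gamma> \<notin> {real_of_int m + real_of_int k * \<alpha> | m k. True}"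
  proof
    assume "\<gamma> \<in> {real_of_int m + real_of_int k * \<alpha> | m k. True}"
    then obtain m n :: int where \<gamma>: "\<gamma> = m + n * \<alpha>" by blast
    \<comment> \<open>The grid would contain the point \<open>(n, 0)\<close> for this fixed
      \<open>n\<close>. A grid point on the axis has \<open>|X|\<close> at least
      \<open>1 / 4\<close> at every level from \<open>N\<close> on, which is impossible once
      \<open>8 * |n| < Q (Suc k)\<close>.\<close>
    obtain k where k: "N \<le> k" "8 * \<bar>real_of_int n\<bar> < Q (Suc k)" using Q_unbounded by blast
    obtain i j :: int where ij: "real_of_int n = Q (Suc k) * ((1 + 2 * i) + (1 + 2 * j) * \<phi> k + S k) / 2"
      "n * \<alpha> - real_of_int (- m) - \<gamma> = d k * ((1 + 2 * j) - (1 + 2 * i) * \<theta> k + T k) / 2"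
      by (rule cell_coords[OF cell[OF k(1)], of n "- m"])
    define I where "I = real_of_int (1 + 2 * i)"
    define J where "J = real_of_int (1 + 2 * j)"
    have "1 \<le> \<bar>1 + 2 * i\<bar>" by presburger
    then have I: "1 \<le> \<bar>I\<bar>" unfolding I_def by linarith
    have "J - I * \<theta> k + T k = 0" using ij(2) \<gamma> d_nonzero[of k] by (simp add: I_def J_def)
    then have J: "J = I * \<theta> k - T k" by simp
    define X where "X = I + J * \<phi> k + S k"
    have n: "real_of_int n = Q (Suc k) * X / 2" using ij(1) unfolding X_def I_def J_def by simp
    have "\<bar>real_of_int n\<bar> = Q (Suc k) * \<bar>X\<bar> / 2"
      unfolding n using Q_pos[of k] by (simp add: abs_mult del: Q.simps)
    then have "4 * (Q (Suc k) * \<bar>X\<bar>) < Q (Suc k)" using k(2) by linarith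
    then have "real_of_int (Q (Suc k)) * (4 * \<bar>X\<bar>) < real_of_int (Q (Suc k)) * 1" by linarith
    then have "4 * \<bar>X\<bar> < 1" using Q_pos[of k] by (simp only: mult_less_cancel_left_pos)
    then have "\<bar>X\<bar> < 1 / 4" by simp
    moreover have "X = I * (1 + \<phi> k * \<theta> k) + (S k - T k * \<phi> k)"
      unfolding X_def J by (simp add: algebra_simps)
    moreover have "1 * 1 \<le> \<bar>I * (1 + \<phi> k * \<theta> k)\<bar>"
      unfolding abs_mult using I \<phi>\<theta>[OF k(1)] by (intro mult_mono) auto
    moreover have "\<bar>T k * \<phi> k\<bar> \<le> 1 / 10 * 1"
      unfolding abs_mult using small(2)[OF k(1)] \<phi>_bounds[of k] by (intro mult_mono) auto
    ultimately show False using small(1)[OF k(1)] by linarith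
  qed
  show "ereal (B / 4) \<le> approx_const \<alpha> \<gamma>"
  proof (rule approx_const_geI[where N = "Q (Suc N)"])
    fix n m :: int assume n: "Q (Suc N) \<le> \<bar>n\<bar>"
    \<comment> \<open>The chosen level has \<open>9 / 10 \<le> |X|\<close> and
      \<open>\<phi> (Suc k) * |X| < 9 / 10\<close>. The factor \<open>9 / 20\<close> is below 1, so
      \<open>P N\<close> fails, and large enough for \<open>9 / 10 * (6 / 5)\<close> to exceed
      \<open>1 + 1 / 100\<close>.\<close>
    define P where "P k \<longleftrightarrow> \<bar>real_of_int n\<bar> < 9 / 20 * Q (Suc k)" for k
    have "\<exists>k\<ge>N. \<not> P k \<and> P (Suc k)"
    proof (rule ccontr)
      assume H: "\<not> ?thesis"
      have nP: "\<not> P k" if "N \<le> k" for k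
        using that
      proof (induction k rule: dec_induct)
        case base
        then show ?case using n Q_pos[of N] unfolding P_def by linarith
      next
        case (step k)
        then show ?case using H by auto
      qed
      obtain k where "N \<le> k" "20 / 9 * \<bar>real_of_int n\<bar> < Q (Suc k)" using Q_unbounded by blast
      then show False using nP[of k] unfolding P_def by simp
    qed
    then obtain k where k: "N \<le> k" "\<not> P k" "P (Suc k)" by blast
    then have k': "N \<le> Suc k" by simp
    obtain i j :: int where ij: "real_of_int n = Q (Suc k) * ((1 + 2 * i) + (1 + 2 * j) * \<phi> k + S k) / 2"
      "n * \<alpha> - m - \<gamma> = d k * ((1 + 2 * j) - (1 + 2 * i) * \<theta> k + T k) / 2"
      by (rule cell_coords[OF cell[OF k(1)], of n m])
    define I where "I = real_of_int (1 + 2 * i)"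
    define J where "J = real_of_int (1 + 2 * j)"
    define X where "X = I + J * \<phi> k + S k"
    define Y where "Y = J - I * \<theta> k + T k"
    have ij': "real_of_int n = Q (Suc k) * X / 2" "n * \<alpha> - m - \<gamma> = d k * Y / 2"
      using ij unfolding X_def Y_def I_def J_def by simp_all
    have absn: "\<bar>real_of_int n\<bar> = Q (Suc k) * \<bar>X\<bar> / 2"
      unfolding ij'(1) using Q_pos[of k] by (simp add: abs_mult del: Q.simps)
    have "Q (Suc k) * (9 / 10) \<le> Q (Suc k) * \<bar>X\<bar>" using k(2) unfolding P_def absn by (simp add: mult_ac del: Q.simps)
    then have X1: "9 / 10 \<le> \<bar>X\<bar>" using Q_pos[of k] by (simp only: mult_le_cancel_left_pos)
    have "Q (Suc (Suc k)) * (\<phi> (Suc k) * \<bar>X\<bar>) < Q (Suc (Suc k)) * (9 / 10)"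
      using k(3) unfolding P_def absn Q_Suc[of k] by (simp add: mult_ac del: Q.simps)
    then have X2: "\<phi> (Suc k) * \<bar>X\<bar> < 9 / 10"
      using Q_pos[of "Suc k"] by (simp only: mult_less_cancel_left_pos)
    obtain c where c: "a (Suc k) + \<tau> (Suc k) = 2 * c" using parity[of k] by blast
    have acr: "real_of_int (a (Suc k)) + \<tau> (Suc k) = 2 * c" using c by linarith
    note small_k = small[OF k(1)] small[OF k']
    note pos = \<phi>_bounds(1)[of k] \<theta>_bounds(1)[of k] \<phi>_pos[of k] less_imp_le[OF \<theta>_bounds(1)[of "Suc k"]]
    have lt: "\<phi> k + \<bar>S k\<bar> < 1" "\<bar>T k\<bar> < 1" "\<phi> (Suc k) + \<bar>S (Suc k)\<bar> < 1"
      "\<theta> (Suc k) + \<bar>T (Suc k)\<bar> < 1"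
      using small_k by linarith+
    have "B * (1 + \<phi> k * \<theta> k) \<le> \<bar>X\<bar> * \<bar>Y\<bar>"
    proof -
      consider "j = 0" | "j = -1" | "3 \<le> \<bar>J\<bar>"
      proof -
        have "j = 0 \<or> j = -1 \<or> 3 \<le> \<bar>1 + 2 * j\<bar>" by presburger
        then show ?thesis using that unfolding J_def by fastforce
      qed
      then show ?thesis
      proof cases
        case 1
        have "i \<le> -1 \<or> 0 \<le> i \<and> i \<le> c - 1 \<or> 0 \<le> i \<and> c \<le> i" by presburger
        then have "I \<le> -1 \<or> 1 \<le> I \<and> I \<le> real_of_int (a (Suc k)) + \<tau> (Suc k) - 1 \<or>
            1 \<le> I \<and> real_of_int (a (Suc k)) + \<tau> (Suc k) + 1 \<le> I"
          unfolding acr I_def by linarith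
        from cell_line_bound[OF pos \<theta>_step \<phi>_step S[OF k(1)] T[OF k(1)] lt
            v2[OF k(1)] v1[OF k(1)] v3[OF k'] v1[OF k'] this]
        show ?thesis unfolding X_def Y_def J_def 1 by simp
      next
        case 2
        \<comment> \<open>Reflection in the origin negates \<open>I\<close>, \<open>S\<close>,
          \<open>T\<close> and the digit, and reduces this line to the previous one.\<close>
        have "even (a (Suc k) - \<tau> (Suc k))" using parity[of k] by simp
        then obtain c' where c': "a (Suc k) - \<tau> (Suc k) = 2 * c'" by (rule evenE)
        then have acr': "real_of_int (a (Suc k)) + - \<tau> (Suc k) = 2 * c'" by linarith
        have "0 \<le> i \<or> i \<le> -1 \<and> - c' \<le> i \<or> i \<le> -1 \<and> i \<le> - 1 - c'" by presburger
        then have "- I \<le> -1 \<or> 1 \<le> - I \<and> - I \<le> real_of_int (a (Suc k)) + - \<tau> (Suc k) - 1 \<or>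
            1 \<le> - I \<and> real_of_int (a (Suc k)) + - \<tau> (Suc k) + 1 \<le> - I"
          unfolding acr' I_def by linarith
        then have "B * (1 + \<phi> k * \<theta> k) \<le> \<bar>- I + \<phi> k + - S k\<bar> * \<bar>1 - - I * \<theta> k + - T k\<bar>"
          using S[OF k(1)] T[OF k(1)] lt v1[OF k(1)] v2[OF k(1)] v3[OF k(1)] v4[OF k(1)]
            v2[OF k'] v4[OF k']
          by (intro cell_line_bound[OF pos \<theta>_step \<phi>_step, where S' = "- S (Suc k)" and
              T' = "- T (Suc k)" and \<tau> = "- \<tau> (Suc k)"]) (auto simp: algebra_simps)
        moreover have "- I + \<phi> k + - S k = - X" "1 - - I * \<theta> k + - T k = - Y"
          unfolding X_def Y_def J_def 2 by simp_all
        ultimately show ?thesis by (simp only: abs_minus_cancel)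
      next
        case 3
        \<comment> \<open>As \<open>\<theta> k\<close> is at most
          \<open>11 / 10 * \<phi> (Suc k)\<close>, the upper condition on the level also bounds
          \<open>\<theta> k * |X|\<close>, so \<open>Y\<close> stays away from 0 when
          \<open>|J|\<close> is at least 3.\<close>
        have "\<theta> k = \<phi> (Suc k) * (a (Suc k) + \<phi> k) * \<theta> k" using \<phi>_step[of k] by simp
        also have "\<dots> \<le> \<phi> (Suc k) * (1 + \<phi> k)"
        proof -
          have "\<theta> k * a (Suc k) \<le> 1"
            using \<theta>_step[of k] mult_nonneg_nonneg[OF less_imp_le[OF pos(2)] pos(4)]
            unfolding distrib_left by linarith
          moreover have "\<phi> k * \<theta> k \<le> \<phi> k * 1" using \<theta>_bounds[of k] pos by (intro mult_left_mono) auto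
          ultimately have "(a (Suc k) + \<phi> k) * \<theta> k \<le> 1 + \<phi> k" by (simp add: algebra_simps)
          then show ?thesis using pos(3) by (simp add: mult.assoc)
        qed
        also have "\<dots> \<le> \<phi> (Suc k) * (11 / 10)" using pos(3) small_k by simp
        finally have "\<theta> k * \<bar>X\<bar> \<le> \<phi> (Suc k) * (11 / 10) * \<bar>X\<bar>" by (intro mult_right_mono) auto
        then have \<theta>X: "\<theta> k * \<bar>X\<bar> \<le> 99 / 100" using X2 by simp
        have "\<bar>J * (\<phi> k * \<theta> k)\<bar> \<le> \<bar>J\<bar> * (1 / 100)"
          unfolding abs_mult[of J] using \<phi>\<theta>[OF k(1)] by (intro mult_left_mono) auto
        moreover have "\<bar>S k * \<theta> k\<bar> \<le> 1 / 10 * (1 / 10)"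
          unfolding abs_mult using small_k \<theta>_bounds(1)[of k] by (intro mult_mono) auto
        moreover have "Y = J - X * \<theta> k + J * (\<phi> k * \<theta> k) + S k * \<theta> k + T k"
          unfolding X_def Y_def by (simp add: algebra_simps)
        moreover have "\<bar>X * \<theta> k\<bar> = \<theta> k * \<bar>X\<bar>" using pos by (simp add: abs_mult)
        ultimately have "6 / 5 \<le> \<bar>Y\<bar>" using 3 \<theta>X small_k(2) by linarith
        have "B * (1 + \<phi> k * \<theta> k) \<le> 1 * (1 + \<phi> k * \<theta> k)"
          using B \<phi>\<theta>[OF k(1)] by (intro mult_right_mono) auto
        also have "\<dots> \<le> 9 / 10 * (6 / 5)" using \<phi>\<theta>[OF k(1)] by simp
        also have "\<dots> \<le> \<bar>X\<bar> * \<bar>Y\<bar>" using X1 \<open>6 / 5 \<le> \<bar>Y\<bar>\<close> by (intro mult_mono) auto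
        finally show ?thesis .
      qed
    qed
    then have "B * (1 + \<phi> k * \<theta> k) \<le> 4 * (\<bar>n\<bar> * \<bar>n * \<alpha> - m - \<gamma>\<bar>) * (1 + \<phi> k * \<theta> k)"
      unfolding grid_product[OF ij'] .
    then have "B \<le> 4 * (\<bar>n\<bar> * \<bar>n * \<alpha> - m - \<gamma>\<bar>)"
      using \<phi>\<theta>[OF k(1)] by (simp only: mult_le_cancel_right_pos)
    then show "B / 4 \<le> \<bar>real_of_int n\<bar> * \<bar>n * \<alpha> - m - \<gamma>\<bar>" by simp
  qed
qed

end

section \<open>Vertex products\<close>

lemma reciprocal_near:
  fixes p x s :: real
  assumes "p * (1 / x + s) = 1" "0 < x" "x \<le> 1 / 1000" "-1 \<le> s" "s \<le> 2"
  shows "x - 2 * x\<^sup>2 \<le> p" "p \<le> x + 2 * x\<^sup>2"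
proof -
  have p: "p * (1 + x * s) = x" using assms(1,2) by (simp add: field_simps)
  have xs: "- x \<le> x * s" "x * s \<le> x * 2"
    using mult_left_mono[of "-1" s x] mult_left_mono[of s 2 x] assms by auto
  then have pos: "0 < 1 + x * s" using assms by linarith
  have "(x - 2 * x\<^sup>2) * (1 + x * s) \<le> (x - 2 * x\<^sup>2) * (1 + x * 2)"
    using xs assms by (intro mult_left_mono) (auto simp: power2_eq_square)
  also have "\<dots> \<le> x" using assms by (simp add: algebra_simps power2_eq_square)
  finally show "x - 2 * x\<^sup>2 \<le> p" using p pos by (metis mult_le_cancel_right_pos)
  have "x \<le> (x + 2 * x\<^sup>2) * (1 - x)"
  proof -
    have "x * x * x \<le> x * x * (1 / 1000)" using assms by (intro mult_left_mono) auto
    then have "x * x * x * 2 \<le> x * x" using assms(2) by simp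
    then show ?thesis by (simp add: algebra_simps power2_eq_square)
  qed
  also have "\<dots> \<le> (x + 2 * x\<^sup>2) * (1 + x * s)" using xs assms by (intro mult_left_mono) auto
  finally show "p \<le> x + 2 * x\<^sup>2" using p pos by (metis mult_le_cancel_right_pos)
qed

text \<open>For a quotient equal to \<open>R\<^sub>*\<close> the error is cubic, whereas
  \<open>reciprocal_near\<close> admits a neighbouring quotient and loses a multiple of
  \<open>x\<^sup>2\<close>.\<close>

lemma reciprocal_close:
  fixes p x r :: real
  assumes "p * (1 / x + r) = 1" "0 < x" "0 \<le> r" "r \<le> 2 * x"
  shows "x - 2 * x ^ 3 \<le> p" "p \<le> x"
proof -
  have p: "p * (1 + x * r) = x" using assms(1,2) by (simp add: field_simps)
  have xr: "0 \<le> x * r" "x * r \<le> x * (2 * x)" using assms by (auto intro: mult_left_mono)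
  then have pos: "0 < 1 + x * r" by linarith
  have "x * 1 \<le> x * (1 + x * r)" using xr assms by (intro mult_left_mono) auto
  then show "p \<le> x" using p pos by (metis mult.right_neutral mult_le_cancel_right_pos)
  show "x - 2 * x ^ 3 \<le> p"
  proof -
    have "0 < p * (1 + x * r)" using p assms(2) by simp
    then have "0 < p" using pos by (simp only: zero_less_mult_pos2)
    then have "p * (1 + x * r) \<le> p * (1 + x * (2 * x))" using xr by (intro mult_left_mono) auto
    then have "x \<le> p * (1 + 2 * x\<^sup>2)" using p by (simp add: power2_eq_square mult.left_commute)
    moreover have "p * (2 * x\<^sup>2) \<le> x * (2 * x\<^sup>2)" using \<open>p \<le> x\<close> by (intro mult_right_mono) auto
    ultimately show ?thesis by (simp add: algebra_simps power2_eq_square power3_eq_cube)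
  qed
qed

text \<open>With the powers of \<open>x\<close> as atoms, these comparisons let linear arithmetic
  settle expanded polynomial inequalities by their leading terms.\<close>

lemma small_powers:
  fixes x :: real
  assumes "0 < x" "x \<le> 1 / 1000"
  shows "0 < x ^ 2" "x ^ 2 \<le> x / 1000" "0 < x ^ 3" "x ^ 3 \<le> x ^ 2 / 1000"
    "0 < x ^ 4" "x ^ 4 \<le> x ^ 3 / 1000" "0 < x ^ 5" "x ^ 5 \<le> x ^ 4 / 1000"
    "0 < x ^ 6" "x ^ 6 \<le> x ^ 5 / 1000"
proof -
  have "x ^ Suc k \<le> x ^ k / 1000" for k
    using assms mult_right_mono[of x "1/1000" "x ^ k"] by simp
  from this[of 1] this[of 2] this[of 3] this[of 4] this[of 5]
  show "x ^ 2 \<le> x / 1000" "x ^ 3 \<le> x ^ 2 / 1000" "x ^ 4 \<le> x ^ 3 / 1000" "x ^ 5 \<le> x ^ 4 / 1000"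
    "x ^ 6 \<le> x ^ 5 / 1000" by (simp_all add: numeral_eq_Suc)
qed (use assms in auto)

text \<open>
  \<open>pS\<close> and \<open>pT\<close> say whether the quotients on the two sides of the level are odd. The only tight
  vertex is the last one, and only when both are.
\<close>

lemma vertices_lower:
  fixes x \<phi> \<theta> S T :: real and pS pT :: bool
  defines "B \<equiv> 1 - 2 * x - 2 * x\<^sup>2 - 20 * x ^ 3"
  assumes x: "0 < x" "x \<le> 1 / 1000"
    and near: "x - 2 * x\<^sup>2 \<le> \<phi>" "\<phi> \<le> x + 2 * x\<^sup>2" "x - 2 * x\<^sup>2 \<le> \<theta>" "\<theta> \<le> x + 2 * x\<^sup>2"
    and p: "pS \<Longrightarrow> x - 2 * x ^ 3 \<le> \<phi> \<and> \<phi> \<le> x \<and> x - 2 * x ^ 3 \<le> S \<and> S \<le> x + x\<^sup>2 + 6 * x ^ 3"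
    and np: "\<not> pS \<Longrightarrow> 0 \<le> S \<and> S \<le> 4 * x\<^sup>2"
    and q: "pT \<Longrightarrow> x - 2 * x ^ 3 \<le> \<theta> \<and> \<theta> \<le> x \<and> x - 4 * x\<^sup>2 \<le> T \<and> T \<le> x + 4 * x ^ 3"
    and nq: "\<not> pT \<Longrightarrow> - 4 * x\<^sup>2 \<le> T \<and> T \<le> 4 * x\<^sup>2"
    and pq: "pS \<or> pT"
  shows "B * (1 + \<phi> * \<theta>) \<le> (1 + \<phi> + S) * (1 - \<theta> + T)"
    "B * (1 + \<phi> * \<theta>) \<le> (1 - \<phi> - S) * (1 + \<theta> + T)"
    "B * (1 + \<phi> * \<theta>) \<le> (1 - \<phi> + S) * (1 + \<theta> - T)"
    "B * (1 + \<phi> * \<theta>) \<le> (1 + \<phi> - S) * (1 - \<theta> - T)"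
proof -
  note sp = small_powers[OF x]
  have B0: "0 \<le> B" unfolding B_def using sp x by linarith
  have prod: "c \<le> P * R" if "u \<le> P" "v \<le> R" "0 \<le> u" "0 \<le> v" "c \<le> u * v" for c u v P R :: real
    using mult_mono[OF that(1,2)] that by linarith
  \<comment> \<open>Even the rough bound \<open>2 * x\<^sup>2\<close> for this product only cancels
    the quadratic term of \<open>B\<close>, so any vertex product of at least
    \<open>1 - 2 * x\<close> is sufficient.\<close>
  have "\<phi> * \<theta> \<le> (x + 2 * x\<^sup>2) * (x + 2 * x\<^sup>2)"
    using near x sp by (intro mult_mono) auto
  also have "\<dots> = x ^ 2 + 4 * x ^ 3 + 4 * x ^ 4" by algebra
  finally have "\<phi> * \<theta> \<le> 2 * x\<^sup>2" using sp x by linarith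
  then have "B * (1 + \<phi> * \<theta>) \<le> B * (1 + 2 * x\<^sup>2)" using B0 by (intro mult_left_mono) auto
  also have "\<dots> = 1 - 2 * x - 24 * x ^ 3 - 4 * x ^ 4 - 40 * x ^ 5" unfolding B_def by algebra
  finally have le: "B * (1 + \<phi> * \<theta>) \<le> 1 - 2 * x" using sp by linarith
  have rough: "- 4 * x\<^sup>2 \<le> T" "T \<le> x + 4 * x\<^sup>2" "0 \<le> S" "S \<le> x + 2 * x\<^sup>2"
    using p np q nq sp x by linarith+
  have "1 - 2 * x \<le> (1 + \<phi> + S) * (1 - \<theta> + T)"
  proof (rule prod[of 1 _ "1 - x - 6 * x\<^sup>2"])
    have "1 - 2 * x \<le> 1 - x - 6 * x\<^sup>2" using sp x by linarith
    then show "1 - 2 * x \<le> 1 * (1 - x - 6 * x\<^sup>2)" by simp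
  qed (use near rough sp x in linarith)+
  with le show "B * (1 + \<phi> * \<theta>) \<le> (1 + \<phi> + S) * (1 - \<theta> + T)" by linarith
  have "1 - 2 * x \<le> (1 - \<phi> - S) * (1 + \<theta> + T)"
  proof (rule prod[of "1 - 2 * x - 4 * x\<^sup>2" _ "1 + x - 6 * x\<^sup>2"])
    have "(1 - 2 * x - 4 * x\<^sup>2) * (1 + x - 6 * x\<^sup>2) = 1 - x - 12 * x^2 + 8 * x ^ 3 + 24 * x ^ 4" by algebra
    then show "1 - 2 * x \<le> (1 - 2 * x - 4 * x\<^sup>2) * (1 + x - 6 * x\<^sup>2)" using sp x by linarith
  qed (use near rough sp x in linarith)+
  with le show "B * (1 + \<phi> * \<theta>) \<le> (1 - \<phi> - S) * (1 + \<theta> + T)" by linarith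
  have "1 - 2 * x \<le> (1 - \<phi> + S) * (1 + \<theta> - T)"
  proof (rule prod[of "1 - x - 2 * x\<^sup>2" _ "1 - 6 * x\<^sup>2"])
    have "(1 - x - 2 * x\<^sup>2) * (1 - 6 * x\<^sup>2) = 1 - x - 8 * x^2 + 6 * x ^ 3 + 12 * x ^ 4" by algebra
    then show "1 - 2 * x \<le> (1 - x - 2 * x\<^sup>2) * (1 - 6 * x\<^sup>2)" using sp x by linarith
  qed (use near rough sp x in linarith)+
  with le show "B * (1 + \<phi> * \<theta>) \<le> (1 - \<phi> + S) * (1 + \<theta> - T)" by linarith
  show "B * (1 + \<phi> * \<theta>) \<le> (1 + \<phi> - S) * (1 - \<theta> - T)"
  proof (cases "pS \<and> pT")
    case True
    \<comment> \<open>Now \<open>S\<close> and \<open>T\<close> both equal \<open>x\<close> to first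
      order. The bounds for the two sides agree up to \<open>1 - 2 * x - x\<^sup>2\<close>, and the
      cubic term of \<open>B\<close> decides.\<close>
    then have "\<phi> * \<theta> \<le> x * x" using p q near x sp by (intro mult_mono) linarith+
    then have "B * (1 + \<phi> * \<theta>) \<le> B * (1 + x\<^sup>2)"
      using B0 by (intro mult_left_mono) (auto simp: power2_eq_square)
    also have "\<dots> = 1 - 2 * x - x ^ 2 - 22 * x ^ 3 - 2 * x ^ 4 - 20 * x ^ 5" unfolding B_def by algebra
    also have "\<dots> \<le> (1 + \<phi> - S) * (1 - \<theta> - T)"
    proof (rule prod[of "1 - x\<^sup>2 - 8 * x ^ 3" _ "1 - 2 * x - 4 * x ^ 3"])
      have "(1 - x\<^sup>2 - 8 * x ^ 3) * (1 - 2 * x - 4 * x ^ 3) =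
          1 - 2 * x - x^2 - 10 * x ^ 3 + 16 * x ^ 4 + 4 * x ^ 5 + 32 * x ^ 6" by algebra
      then show "1 - 2 * x - x ^ 2 - 22 * x ^ 3 - 2 * x ^ 4 - 20 * x ^ 5
          \<le> (1 - x\<^sup>2 - 8 * x ^ 3) * (1 - 2 * x - 4 * x ^ 3)" using sp x by linarith
    qed (use True p q sp x in linarith)+
    finally show ?thesis .
  next
    case False
    have "1 - 2 * x \<le> (1 + \<phi> - S) * (1 - \<theta> - T)"
    proof (cases pS)
      case True
      then have "\<not> pT" using False by blast
      show ?thesis
      proof (rule prod[of "1 - 4 * x\<^sup>2" _ "1 - x - 6 * x\<^sup>2"])
        have "(1 - 4 * x\<^sup>2) * (1 - x - 6 * x\<^sup>2) = 1 - x - 10 * x^2 + 4 * x ^ 3 + 24 * x ^ 4" by algebra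
        then show "1 - 2 * x \<le> (1 - 4 * x\<^sup>2) * (1 - x - 6 * x\<^sup>2)" using sp x by linarith
      qed (use p[OF True] nq[OF \<open>\<not> pT\<close>] near sp x in linarith)+
    next
      case False
      show ?thesis
      proof (rule prod[of "1 + x - 6 * x\<^sup>2" _ "1 - 2 * x - 4 * x\<^sup>2"])
        have "(1 + x - 6 * x\<^sup>2) * (1 - 2 * x - 4 * x\<^sup>2) = 1 - x - 12 * x^2 + 8 * x ^ 3 + 24 * x ^ 4" by algebra
        then show "1 - 2 * x \<le> (1 + x - 6 * x\<^sup>2) * (1 - 2 * x - 4 * x\<^sup>2)" using sp x by linarith
      qed (use np[OF False] q pq False near sp x in linarith)+
    qed
    with le show ?thesis by linarith
  qed
qed

text \<open>To leading order the products are \<open>(1 + \<xi>) * (1 + \<eta>)\<close> and its sign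
  variants; adding two of them cancels one variable and bounds the other.\<close>

lemma vertices_force_small_center:
  fixes x \<phi> \<theta> \<xi> \<eta> b :: real
  assumes x: "0 < x" "x \<le> 1 / 1000" and b: "1 - 3 * x \<le> b"
    and pt: "0 \<le> \<phi>" "\<phi> \<le> 2 * x" "0 \<le> \<theta>" "\<theta> \<le> 2 * x" and \<xi>\<eta>: "\<bar>\<xi>\<bar> \<le> 1" "\<bar>\<eta>\<bar> \<le> 1"
    and v: "b \<le> \<bar>(1 + \<xi>) + (1 + \<eta>) * \<phi>\<bar> * \<bar>(1 + \<eta>) - (1 + \<xi>) * \<theta>\<bar>"
      "b \<le> \<bar>(-1 + \<xi>) + (1 + \<eta>) * \<phi>\<bar> * \<bar>(1 + \<eta>) - (-1 + \<xi>) * \<theta>\<bar>"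
      "b \<le> \<bar>(1 + \<xi>) + (-1 + \<eta>) * \<phi>\<bar> * \<bar>(-1 + \<eta>) - (1 + \<xi>) * \<theta>\<bar>"
      "b \<le> \<bar>(-1 + \<xi>) + (-1 + \<eta>) * \<phi>\<bar> * \<bar>(-1 + \<eta>) - (-1 + \<xi>) * \<theta>\<bar>"
  shows "\<bar>\<xi>\<bar> \<le> 20 * x" "\<bar>\<eta>\<bar> \<le> 20 * x"
proof -
  have key: "1 - 20 * x \<le> \<bar>A\<bar> * \<bar>B\<bar>" if "b \<le> \<bar>A + B * \<phi>\<bar> * \<bar>B - A * \<theta>\<bar>" "\<bar>A\<bar> \<le> 2" "\<bar>B\<bar> \<le> 2"
    for A B :: real
  proof -
    have "\<bar>B * \<phi>\<bar> = \<bar>B\<bar> * \<phi>" "\<bar>A * \<theta>\<bar> = \<bar>A\<bar> * \<theta>" using pt by (auto simp: abs_mult)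
    then have "\<bar>A + B * \<phi>\<bar> * \<bar>B - A * \<theta>\<bar> \<le> (\<bar>A\<bar> + \<bar>B\<bar> * \<phi>) * (\<bar>B\<bar> + \<bar>A\<bar> * \<theta>)"
      using pt by (intro mult_mono) linarith+
    also have "\<dots> = \<bar>A\<bar> * \<bar>B\<bar> + \<bar>A\<bar> * \<bar>A\<bar> * \<theta> + \<bar>B\<bar> * \<bar>B\<bar> * \<phi> + \<bar>A\<bar> * \<bar>B\<bar> * (\<phi> * \<theta>)" by algebra
    also have "\<dots> \<le> \<bar>A\<bar> * \<bar>B\<bar> + 2 * 2 * (2 * x) + 2 * 2 * (2 * x) + 2 * 2 * ((2 * x) * (2 * x))"
      using that pt x by (intro add_mono mult_mono order_refl) auto
    finally have "b \<le> \<bar>A\<bar> * \<bar>B\<bar> + 16 * x + 16 * x\<^sup>2" using that(1) by (simp add: power2_eq_square)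
    then show ?thesis using b small_powers(2)[OF x] x by linarith
  qed
  have "\<bar>1 + \<xi>\<bar> = 1 + \<xi>" "\<bar>-1 + \<xi>\<bar> = 1 - \<xi>" "\<bar>1 + \<eta>\<bar> = 1 + \<eta>" "\<bar>-1 + \<eta>\<bar> = 1 - \<eta>"
    "\<bar>1 + \<xi>\<bar> \<le> 2" "\<bar>-1 + \<xi>\<bar> \<le> 2" "\<bar>1 + \<eta>\<bar> \<le> 2" "\<bar>-1 + \<eta>\<bar> \<le> 2"
    using \<xi>\<eta> by linarith+
  then have 1: "1 - 20 * x \<le> (1 + \<xi>) * (1 + \<eta>)" and 2: "1 - 20 * x \<le> (1 - \<xi>) * (1 + \<eta>)"
    and 3: "1 - 20 * x \<le> (1 + \<xi>) * (1 - \<eta>)" and 4: "1 - 20 * x \<le> (1 - \<xi>) * (1 - \<eta>)"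
    using key[OF v(1)] key[OF v(2)] key[OF v(3)] key[OF v(4)] by simp_all
  show "\<bar>\<xi>\<bar> \<le> 20 * x" "\<bar>\<eta>\<bar> \<le> 20 * x" using 1 2 3 4 by (simp_all add: algebra_simps abs_le_iff)
qed

text \<open>Up to quadratic terms the products are 1 plus the four sign combinations of
  \<open>S\<close> and \<open>T\<close>, because \<open>\<phi> - \<theta>\<close> is itself
  quadratic. This will limit the absolute values of two neighbouring digits to a sum of at most
  2.\<close>

lemma vertices_force_digit_sum:
  fixes x \<phi> \<theta> S T b :: real
  assumes x: "0 < x" "x \<le> 1 / 1000" and b: "1 - 2 * x - 2 * x\<^sup>2 \<le> b"
    and near: "x - 2 * x\<^sup>2 \<le> \<phi>" "\<phi> \<le> x + 2 * x\<^sup>2" "x - 2 * x\<^sup>2 \<le> \<theta>" "\<theta> \<le> x + 2 * x\<^sup>2"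
    and ST: "\<bar>S\<bar> \<le> 21 * x" "\<bar>T\<bar> \<le> 21 * x"
    and v: "b \<le> (1 + \<phi> + S) * (1 - \<theta> + T)" "b \<le> (1 - \<phi> - S) * (1 + \<theta> + T)"
    "b \<le> (1 - \<phi> + S) * (1 + \<theta> - T)" "b \<le> (1 + \<phi> - S) * (1 - \<theta> - T)"
  shows "\<bar>S\<bar> + \<bar>T\<bar> \<le> 2 * x + 550 * x\<^sup>2"
proof -
  note sp = small_powers[OF x]
  have q: "\<bar>u * w\<bar> \<le> c * d * x\<^sup>2" if "\<bar>u\<bar> \<le> c * x" "\<bar>w\<bar> \<le> d * x" "0 \<le> c" for u w c d :: real
  proof -
    have "\<bar>u * w\<bar> \<le> (c * x) * (d * x)" unfolding abs_mult using that x by (intro mult_mono) auto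
    then show ?thesis by (simp add: power2_eq_square algebra_simps)
  qed
  have pt: "\<bar>\<phi>\<bar> \<le> (11/10) * x" "\<bar>\<theta>\<bar> \<le> (11/10) * x" using near sp x by linarith+
  have qq: "\<bar>\<phi> * \<theta>\<bar> \<le> 2 * x\<^sup>2" "\<bar>\<phi> * T\<bar> \<le> 24 * x\<^sup>2" "\<bar>S * \<theta>\<bar> \<le> 24 * x\<^sup>2" "\<bar>S * T\<bar> \<le> 441 * x\<^sup>2"
    using q[OF pt(1) pt(2)] q[OF pt(1) ST(2)] q[OF ST(1) pt(2)] q[OF ST] sp(1) by auto
  have e: "(1 + \<phi> + S) * (1 - \<theta> + T) = 1 + \<phi> - \<theta> + S + T - \<phi> * \<theta> + \<phi> * T - S * \<theta> + S * T"
    "(1 - \<phi> - S) * (1 + \<theta> + T) = 1 - \<phi> + \<theta> - S + T - \<phi> * \<theta> - \<phi> * T - S * \<theta> - S * T"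
    "(1 - \<phi> + S) * (1 + \<theta> - T) = 1 - \<phi> + \<theta> + S - T - \<phi> * \<theta> + \<phi> * T + S * \<theta> - S * T"
    "(1 + \<phi> - S) * (1 - \<theta> - T) = 1 + \<phi> - \<theta> - S - T - \<phi> * \<theta> - \<phi> * T + S * \<theta> + S * T"
    by algebra+
  have "- 2 * x - 550 * x\<^sup>2 \<le> S + T" "- 2 * x - 550 * x\<^sup>2 \<le> - S + T"
    "- 2 * x - 550 * x\<^sup>2 \<le> S - T" "- 2 * x - 550 * x\<^sup>2 \<le> - S - T"
    using v[unfolded e] b near qq[THEN abs_le_D1] qq[THEN abs_le_D2] sp by linarith+
  then show ?thesis by linarith
qed

text \<open>\<open>s\<close> and \<open>t\<close> are the digits on the two sides, and
  \<open>p\<close> tells whether \<open>S\<close> or \<open>T\<close> carries the extra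
  \<open>x\<^sup>2\<close>. The vertex picked by their signs has product at most
  \<open>1 - 2 * x - x\<^sup>2\<close> plus about \<open>66 * x ^ 3\<close>, while \<open>b\<close>
  has at least \<open>77 * x ^ 3\<close> in that place.\<close>

lemma vertices_upper:
  fixes x \<phi> \<theta> S T s t p :: real
  defines "b \<equiv> (1 - 2 * x - 2 * x\<^sup>2 + 80 * x ^ 3) * (1 + \<phi> * \<theta>)"
  assumes x: "0 < x" "x \<le> 1 / 1000"
    and close: "x - 2 * x ^ 3 \<le> \<phi>" "\<phi> \<le> x" "x - 2 * x ^ 3 \<le> \<theta>" "\<theta> \<le> x"
    and ST: "\<bar>S\<bar> \<le> 21 * x" "\<bar>T\<bar> \<le> 21 * x"
    and v: "b \<le> (1 + \<phi> + S) * (1 - \<theta> + T)" "b \<le> (1 - \<phi> - S) * (1 + \<theta> + T)"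
      "b \<le> (1 - \<phi> + S) * (1 + \<theta> - T)" "b \<le> (1 + \<phi> - S) * (1 - \<theta> - T)"
    and st: "s = 1 \<or> s = -1" "t = 1 \<or> t = -1" and p: "p = 0 \<or> p = 1"
    and S: "x + p * x\<^sup>2 - 30 * x ^ 3 \<le> s * S" and T: "x + (1 - p) * x\<^sup>2 - 30 * x ^ 3 \<le> t * T"
  shows False
proof -
  note sp = small_powers[OF x]
  have "(x - 2 * x ^ 3) * (x - 2 * x ^ 3) \<le> \<phi> * \<theta>" using close sp x by (intro mult_mono) linarith+
  moreover have "(x - 2 * x ^ 3) * (x - 2 * x ^ 3) = x ^ 2 - 4 * x ^ 4 + 4 * x ^ 6" by algebra
  ultimately have "x\<^sup>2 - 4 * x ^ 4 \<le> \<phi> * \<theta>" using sp by linarith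
  then have "(1 - 2 * x - 2 * x\<^sup>2 + 80 * x ^ 3) * (1 + (x\<^sup>2 - 4 * x ^ 4)) \<le> b"
    unfolding b_def using sp x by (intro mult_left_mono) linarith+
  moreover have "(1 - 2 * x - 2 * x\<^sup>2 + 80 * x ^ 3) * (1 + (x\<^sup>2 - 4 * x ^ 4)) =
      1 - 2 * x - x ^ 2 + 78 * x ^ 3 - 6 * x ^ 4 + 88 * x ^ 5 + 8 * x ^ 6 - 320 * x ^ 7" by algebra
  moreover have "x ^ 7 \<le> x ^ 6 / 1000"
    using x mult_right_mono[of x "1/1000" "x ^ 6"] by (simp add: numeral_eq_Suc)
  ultimately have b: "1 - 2 * x - x\<^sup>2 + 77 * x ^ 3 \<le> b" using sp by linarith
  have prod: False if "b \<le> P * R" "P \<le> 1 - c * x\<^sup>2 + 32 * x ^ 3"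
    "R \<le> 1 - 2 * x - (1 - c) * x\<^sup>2 + 32 * x ^ 3" "0 \<le> R" "c = 0 \<or> c = 1" for P R c :: real
  proof -
    have "P * R \<le> (1 - c * x\<^sup>2 + 32 * x ^ 3) * (1 - 2 * x - (1 - c) * x\<^sup>2 + 32 * x ^ 3)"
      using that sp x by (intro mult_mono) auto
    moreover have "(1 - c * x\<^sup>2 + 32 * x ^ 3) * (1 - 2 * x - (1 - c) * x\<^sup>2 + 32 * x ^ 3) =
        1 - 2 * x - x ^ 2 + 64 * x ^ 3 + 2 * (c * x ^ 3) + c * (1 - c) * x ^ 4 - 64 * x ^ 4
        - 32 * x ^ 5 + 1024 * x ^ 6"
      by algebra
    moreover have "c * (1 - c) * x ^ 4 = 0" "c * x ^ 3 \<le> x ^ 3" using that(5) sp x by auto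
    ultimately show False using b that(1) sp by linarith
  qed
  from st consider "s = 1" "t = 1" | "s = 1" "t = -1" | "s = -1" "t = 1" | "s = -1" "t = -1" by blast
  then show False
  proof cases
    case 1
    show False by (rule prod[OF v(4), of p]) (use 1 S T close ST p sp x in \<open>auto simp: abs_le_iff\<close>)
  next
    case 2
    show False by (rule prod[OF v(2)[unfolded mult.commute[of "1 - \<phi> - S"]], of "1 - p"])
      (use 2 S T close ST p sp x in \<open>auto simp: abs_le_iff\<close>)
  next
    case 3
    show False by (rule prod[OF v(3)[unfolded mult.commute[of "1 - \<phi> + S"]], of "1 - p"])
      (use 3 S T close ST p sp x in \<open>auto simp: abs_le_iff\<close>)
  next
    case 4
    show False by (rule prod[OF v(1), of p]) (use 4 S T close ST p sp x in \<open>auto simp: abs_le_iff\<close>)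
  qed
qed

section \<open>Partial quotients of two neighbouring values\<close>

text \<open>The threshold 1000 makes the numerical estimates in \<open>x\<close> work; smaller
  quotients are left to the constant of the theorem.\<close>

locale two_quotient_cf = irrational_cf +
  fixes N :: nat and R\<^sub>o R\<^sub>e :: int and x :: real
  assumes R\<^sub>o: "odd R\<^sub>o" "1000 \<le> R\<^sub>o" and R\<^sub>e: "R\<^sub>e = R\<^sub>o - 1 \<or> R\<^sub>e = R\<^sub>o + 1"
    and quotients: "\<And>k. N \<le> k \<Longrightarrow> a k = R\<^sub>o \<or> a k = R\<^sub>e"
    and x_def: "x = 1 / R\<^sub>o"
begin

lemma x: "0 < x" "x \<le> 1 / 1000"
proof -
  have "1000 \<le> real_of_int R\<^sub>o" using R\<^sub>o(2) by linarith
  then show "0 < x" "x \<le> 1 / 1000" unfolding x_def by (auto simp: divide_simps)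
qed

lemmas small = small_powers[OF x]

lemma R\<^sub>o_eq: "real_of_int R\<^sub>o = 1 / x"
  unfolding x_def by simp

lemma odd_quotient: "N \<le> k \<Longrightarrow> odd (a k) \<longleftrightarrow> a k = R\<^sub>o"
  using quotients[of k] R\<^sub>o(1) R\<^sub>e by auto

lemma quotient_near:
  assumes "N \<le> k" "0 \<le> r" "r \<le> 1"
  shows "\<exists>s. real_of_int (a k) + r = 1 / x + s \<and> -1 \<le> s \<and> s \<le> 2"
proof -
  have "real_of_int R\<^sub>o - 1 \<le> a k" "a k \<le> real_of_int R\<^sub>o + 1"
    using quotients[OF assms(1)] R\<^sub>e by auto
  then show ?thesis using assms R\<^sub>o_eq by (intro exI[of _ "a k + r - 1 / x"]) auto
qed

lemma \<phi>_near:
  assumes "N < k"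
  shows "x - 2 * x\<^sup>2 \<le> \<phi> k" "\<phi> k \<le> x + 2 * x\<^sup>2"
proof -
  obtain j where k: "k = Suc j" using assms by (cases k) auto
  obtain s where s: "real_of_int (a k) + \<phi> j = 1 / x + s" "-1 \<le> s" "s \<le> 2"
    using quotient_near[of k "\<phi> j"] \<phi>_bounds[of j] assms by auto
  have "\<phi> k * (1 / x + s) = 1" using \<phi>_step[of j] s(1) unfolding k by simp
  from reciprocal_near[OF this x s(2,3)] show "x - 2 * x\<^sup>2 \<le> \<phi> k" "\<phi> k \<le> x + 2 * x\<^sup>2" .
qed

lemma \<theta>_near:
  assumes "N \<le> k"
  shows "x - 2 * x\<^sup>2 \<le> \<theta> k" "\<theta> k \<le> x + 2 * x\<^sup>2"
proof -
  obtain s where s: "real_of_int (a (Suc k)) + \<theta> (Suc k) = 1 / x + s" "-1 \<le> s" "s \<le> 2"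
    using quotient_near[of "Suc k" "\<theta> (Suc k)"] \<theta>_bounds[of "Suc k"] assms by (auto simp del: \<theta>.simps)
  have "\<theta> k * (1 / x + s) = 1" using \<theta>_step[of k] s(1) by (simp del: \<theta>.simps)
  from reciprocal_near[OF this x s(2,3)] show "x - 2 * x\<^sup>2 \<le> \<theta> k" "\<theta> k \<le> x + 2 * x\<^sup>2" .
qed

lemma \<phi>_close:
  assumes "Suc N < k" "a k = R\<^sub>o"
  shows "x - 2 * x ^ 3 \<le> \<phi> k" "\<phi> k \<le> x"
proof -
  obtain j where k: "k = Suc j" using assms by (cases k) auto
  have "\<phi> k * (1 / x + \<phi> j) = 1" using \<phi>_step[of j] assms(2) R\<^sub>o_eq unfolding k by simp
  moreover have "\<phi> j \<le> 2 * x" using \<phi>_near(2)[of j] assms(1) k small x by simp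
  ultimately show "x - 2 * x ^ 3 \<le> \<phi> k" "\<phi> k \<le> x"
    using reciprocal_close[of "\<phi> k" x "\<phi> j"] x \<phi>_bounds[of j] by auto
qed

lemma \<theta>_close:
  assumes "N \<le> k" "a (Suc k) = R\<^sub>o"
  shows "x - 2 * x ^ 3 \<le> \<theta> k" "\<theta> k \<le> x"
proof -
  have "\<theta> k * (1 / x + \<theta> (Suc k)) = 1"
    using \<theta>_step[of k] assms(2) R\<^sub>o_eq by (simp del: \<theta>.simps)
  moreover have "\<theta> (Suc k) \<le> 2 * x" using \<theta>_near(2)[of "Suc k"] assms(1) small x by (simp del: \<theta>.simps)
  ultimately show "x - 2 * x ^ 3 \<le> \<theta> k" "\<theta> k \<le> x"
    using reciprocal_close[of "\<theta> k" x "\<theta> (Suc k)"] x \<theta>_bounds[of "Suc k"] by (auto simp del: \<theta>.simps)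
qed

lemma \<phi>_le: "N < k \<Longrightarrow> \<phi> k \<le> 11 / 10 * x"
  using \<phi>_near(2)[of k] small x by linarith

lemma \<theta>_le: "N \<le> k \<Longrightarrow> \<theta> k \<le> 11 / 10 * x"
  using \<theta>_near(2)[of k] small x by linarith

text \<open>The digits are the residues \<open>a k mod 2\<close>, which keep \<open>S\<close>
  nonnegative. As no two even quotients are adjacent, every level has an odd one beside it, as
  \<open>vertices_lower\<close> requires.\<close>

lemma lower_bound:
  assumes no_consecutive_even: "\<And>k. N \<le> k \<Longrightarrow> a k = R\<^sub>o \<or> a (Suc k) = R\<^sub>o"
  shows "\<exists>\<gamma>. \<gamma> \<notin> {real_of_int m + real_of_int k * \<alpha> | m k. True} \<and>
    ereal ((1 - 2 * x - 2 * x\<^sup>2 - 20 * x ^ 3) / 4) \<le> approx_const \<alpha> \<gamma>"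
proof -
  define \<tau> :: "nat \<Rightarrow> int" where "\<tau> k = a k mod 2" for k
  have parity: "even (a (Suc k) + \<tau> (Suc k))" for k unfolding \<tau>_def by presburger
  have \<tau>01: "\<tau> k = 0 \<or> \<tau> k = 1" for k unfolding \<tau>_def by presburger
  have \<tau>_odd: "\<tau> k = (if a k = R\<^sub>o then 1 else 0)" if "N \<le> k" for k
    using odd_quotient[OF that] unfolding \<tau>_def by presburger
  have a2: "2 \<le> a (Suc k)" if "N \<le> k" for k using quotients[of "Suc k"] that R\<^sub>o R\<^sub>e by auto
  have \<tau>1: "\<bar>\<tau> k\<bar> \<le> 1" for k using \<tau>01[of k] by auto
  obtain T :: "nat \<Rightarrow> real" where
    T_all: "\<forall>k\<ge>N. T k = \<theta> k * (\<tau> (Suc k) - T (Suc k))" "\<forall>k\<ge>N. \<bar>T k\<bar> \<le> 1"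
    by (rule bounded_tail_exists[of N \<tau>, OF a2 \<tau>1])
  note T = T_all(1)[rule_format] and T1 = T_all(2)[rule_format]
  obtain \<gamma> :: real and S :: "nat \<Rightarrow> real" where S0: "S N = 1 - \<phi> N"
    and S_all: "\<forall>k\<ge>N. S (Suc k) = \<phi> (Suc k) * (\<tau> (Suc k) + S k)"
    and cell_all: "\<forall>k\<ge>N. cell \<gamma> k (S k) (T k)"
    by (rule cell_sequence_exists[of N T \<tau>, OF T parity])
  note S = S_all[rule_format] and cell = cell_all[rule_format]
  have \<tau>r: "real_of_int (\<tau> k) = 0 \<or> real_of_int (\<tau> k) = 1" for k using \<tau>01[of k] by auto
  \<comment> \<open>Bootstrapping: the bound 1 for \<open>|T k|\<close> gives \<open>3 * x\<close>,
    and feeding that back gives the quadratic lower bound \<open>T4\<close>. Likewise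
    \<open>S\<close> sharpens level by level from 1 to \<open>3 * x\<close> to
    \<open>x + 6 * x\<^sup>2\<close>.\<close>
  have T3: "\<bar>T k\<bar> \<le> 3 * x" if "N \<le> k" for k
  proof -
    have "\<bar>T k\<bar> \<le> (11 / 10 * x) * 2"
      unfolding T[OF that] abs_mult using \<theta>_le[OF that] \<theta>_bounds(1)[of k] \<tau>r[of "Suc k"] T1[of "Suc k"] that
      by (intro mult_mono) auto
    then show ?thesis using x by linarith
  qed
  have S1: "0 \<le> S k \<and> S k \<le> 1" if "N \<le> k" for k
    using that
  proof (induction k rule: dec_induct)
    case base
    then show ?case using S0 \<phi>_bounds[of N] by simp
  next
    case (step k)
    have "\<phi> (Suc k) * (\<tau> (Suc k) + S k) \<le> 1 / 2 * 2"
      using step \<tau>r[of "Suc k"] \<phi>_le[of "Suc k"] x by (intro mult_mono) auto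
    then show ?case using S[OF step.hyps(1)] step \<phi>_bounds(1)[of "Suc k"] \<tau>r[of "Suc k"] by auto
  qed
  have S3: "S (Suc k) \<le> 3 * x" if "N \<le> k" for k
  proof -
    have "S (Suc k) \<le> (11 / 10 * x) * 2"
      unfolding S[OF that] using \<phi>_le[of "Suc k"] that \<tau>r[of "Suc k"] S1[OF that] x
      by (intro mult_mono) auto
    then show ?thesis using x by linarith
  qed
  have S6: "S (Suc (Suc k)) \<le> x + 6 * x\<^sup>2" if "N \<le> k" for k
  proof -
    have "S (Suc (Suc k)) \<le> (x + 2 * x\<^sup>2) * (1 + 3 * x)"
      unfolding S[OF le_SucI[OF that]]
      using \<phi>_near(2)[of "Suc (Suc k)"] that \<tau>r[of "Suc (Suc k)"] S3[OF that] S1[of "Suc k"] x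
      by (intro mult_mono) auto
    also have "\<dots> = x + 5 * x ^ 2 + 6 * x ^ 3" by algebra
    finally show ?thesis using small by linarith
  qed
  have T4: "- 4 * x\<^sup>2 \<le> T k" if "N \<le> k" for k
  proof -
    have "\<theta> k * (- (3 * x)) \<le> \<theta> k * (\<tau> (Suc k) - T (Suc k))"
      using \<theta>_bounds(1)[of k] \<tau>r[of "Suc k"] T3[of "Suc k"] that by (intro mult_left_mono) auto
    moreover have "\<theta> k * (3 * x) \<le> (11 / 10 * x) * (3 * x)"
      using \<theta>_le[OF that] x by (intro mult_right_mono) auto
    moreover have "(11 / 10 * x) * (3 * x) = 33 / 10 * x\<^sup>2" by (simp add: power2_eq_square)
    ultimately have "- (33 / 10) * x\<^sup>2 \<le> T k" unfolding T[OF that, symmetric] by linarith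
    then show ?thesis using small by linarith
  qed
  \<comment> \<open>Three levels after \<open>N\<close>, the sharpened bound \<open>S6\<close> holds
    for the predecessor of \<open>S k\<close>.\<close>
  define M where "M = Suc (Suc (Suc N))"
  let ?B = "1 - 2 * x - 2 * x\<^sup>2 - 20 * x ^ 3"
  have vertices: "?B * (1 + \<phi> k * \<theta> k) \<le> (1 + \<phi> k + S k) * (1 - \<theta> k + T k)"
      "?B * (1 + \<phi> k * \<theta> k) \<le> (1 - \<phi> k - S k) * (1 + \<theta> k + T k)"
      "?B * (1 + \<phi> k * \<theta> k) \<le> (1 - \<phi> k + S k) * (1 + \<theta> k - T k)"
      "?B * (1 + \<phi> k * \<theta> k) \<le> (1 + \<phi> k - S k) * (1 - \<theta> k - T k)" if "M \<le> k" for k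
  proof -
    obtain j where k: "k = Suc (Suc (Suc j))" and "N \<le> j"
      using \<open>M \<le> k\<close> unfolding M_def by (metis Suc_le_D Suc_le_mono)
    have Nk: "N < k" "N \<le> k" "Suc N < k" using \<open>N \<le> j\<close> k by auto
    have Sk: "S k = \<phi> k * (\<tau> k + S (Suc (Suc j)))" unfolding k using S[of "Suc (Suc j)"] \<open>N \<le> j\<close> by simp
    have S': "0 \<le> S (Suc (Suc j))" "S (Suc (Suc j)) \<le> x + 6 * x\<^sup>2" "S (Suc (Suc j)) \<le> 3 * x"
      using S1[of "Suc (Suc j)"] S6[of j] S3[of "Suc j"] \<open>N \<le> j\<close> by auto
    have p: "x - 2 * x ^ 3 \<le> \<phi> k \<and> \<phi> k \<le> x \<and> x - 2 * x ^ 3 \<le> S k \<and> S k \<le> x + x\<^sup>2 + 6 * x ^ 3"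
      if "a k = R\<^sub>o"
    proof -
      note c = \<phi>_close[OF Nk(3) that]
      have "\<tau> k = 1" using \<tau>_odd[OF Nk(2)] that by simp
      then have Sk': "S k = \<phi> k * (1 + S (Suc (Suc j)))" using Sk by simp
      have "\<phi> k * 1 \<le> S k" unfolding Sk' using S' \<phi>_bounds(1)[of k] by (intro mult_left_mono) auto
      moreover have "S k \<le> x * (1 + (x + 6 * x\<^sup>2))" unfolding Sk' using c S' x by (intro mult_mono) auto
      moreover have "x * (1 + (x + 6 * x\<^sup>2)) = x + x\<^sup>2 + 6 * x ^ 3" by algebra
      ultimately show ?thesis using c by linarith
    qed
    have np: "0 \<le> S k \<and> S k \<le> 4 * x\<^sup>2" if "a k \<noteq> R\<^sub>o"
    proof -
      have "\<tau> k = 0" using \<tau>_odd[OF Nk(2)] that by simp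
      then have "S k = \<phi> k * S (Suc (Suc j))" using Sk by simp
      also have "\<dots> \<le> (11 / 10 * x) * (3 * x)" using \<phi>_le[OF Nk(1)] S' x by (intro mult_mono) auto
      finally show ?thesis using S1[OF Nk(2)] small by (simp add: power2_eq_square)
    qed
    have q: "x - 2 * x ^ 3 \<le> \<theta> k \<and> \<theta> k \<le> x \<and> x - 4 * x\<^sup>2 \<le> T k \<and> T k \<le> x + 4 * x ^ 3"
      if "a (Suc k) = R\<^sub>o"
    proof -
      note c = \<theta>_close[OF Nk(2) that]
      have "\<tau> (Suc k) = 1" using \<tau>_odd[of "Suc k"] Nk that by simp
      then have Tk: "T k = \<theta> k * (1 - T (Suc k))" using T[OF Nk(2)] by simp
      have T': "\<bar>T (Suc k)\<bar> \<le> 3 * x" "- 4 * x\<^sup>2 \<le> T (Suc k)" using T3[of "Suc k"] T4[of "Suc k"] Nk by auto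
      have "(x - 2 * x ^ 3) * (1 - 3 * x) \<le> T k"
        unfolding Tk using c T' x small \<theta>_bounds(1)[of k] by (intro mult_mono) auto
      moreover have "(x - 2 * x ^ 3) * (1 - 3 * x) = x - 3 * x ^ 2 - 2 * x ^ 3 + 6 * x ^ 4" by algebra
      moreover have "T k \<le> x * (1 + 4 * x\<^sup>2)"
        unfolding Tk using c T' x by (intro mult_mono) auto
      moreover have "x * (1 + 4 * x\<^sup>2) = x + 4 * x ^ 3" by algebra
      ultimately show ?thesis using c small by linarith
    qed
    have nq: "- 4 * x\<^sup>2 \<le> T k \<and> T k \<le> 4 * x\<^sup>2" if "a (Suc k) \<noteq> R\<^sub>o"
    proof -
      have "\<tau> (Suc k) = 0" using \<tau>_odd[of "Suc k"] Nk that by simp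
      then have "\<bar>T k\<bar> = \<theta> k * \<bar>T (Suc k)\<bar>" using T[OF Nk(2)] \<theta>_bounds(1)[of k] by (simp add: abs_mult)
      also have "\<dots> \<le> (11 / 10 * x) * (3 * x)"
        using \<theta>_le[OF Nk(2)] T3[of "Suc k"] Nk x by (intro mult_mono) auto
      finally have "\<bar>T k\<bar> \<le> 33 / 10 * x\<^sup>2" by (simp add: power2_eq_square)
      then show ?thesis using small by linarith
    qed
    show "?B * (1 + \<phi> k * \<theta> k) \<le> (1 + \<phi> k + S k) * (1 - \<theta> k + T k)"
      "?B * (1 + \<phi> k * \<theta> k) \<le> (1 - \<phi> k - S k) * (1 + \<theta> k + T k)"
      "?B * (1 + \<phi> k * \<theta> k) \<le> (1 - \<phi> k + S k) * (1 + \<theta> k - T k)"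
      "?B * (1 + \<phi> k * \<theta> k) \<le> (1 + \<phi> k - S k) * (1 - \<theta> k - T k)"
      using vertices_lower[OF x \<phi>_near[OF Nk(1)] \<theta>_near[OF Nk(2)] p np q nq no_consecutive_even[OF Nk(2)]]
      by blast+
  qed
  have MN: "N \<le> k" "N < k" if "M \<le> k" for k using that unfolding M_def by auto
  have Sb: "\<bar>S k\<bar> \<le> 1 / 10" if "M \<le> k" for k
  proof -
    obtain j where k: "k = Suc j" "N \<le> j" using \<open>M \<le> k\<close> unfolding M_def by (cases k) auto
    then show ?thesis using S3[OF k(2)] S1[of k] x by auto
  qed
  have Tb: "\<bar>T k\<bar> \<le> 1 / 10" "\<phi> k \<le> 1 / 10" "\<theta> k \<le> 1 / 10" if "M \<le> k" for k
    using T3[OF MN(1)[OF that]] \<phi>_le[OF MN(2)[OF that]] \<theta>_le[OF MN(1)[OF that]] x by linarith+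
  have B1: "?B \<le> 1" using small x by linarith
  show ?thesis
    using cell_sequence_lower[of M \<gamma> S T \<tau> ?B, OF cell[OF MN(1)] S[OF MN(1)] T[OF MN(1)] parity
        Sb Tb B1 vertices]
    by blast
qed

text \<open>The vertices of the cell from \<open>cell_exists\<close> satisfy the hypothesis, which
  forces its centre to be of order \<open>x\<close>. They then lie in four different quadrants, so
  the absolute values open with known signs.\<close>

lemma level_center:
  fixes \<gamma> :: real
  defines "\<beta> \<equiv> 1 - 2 * x - 2 * x\<^sup>2 + 80 * x ^ 3"
  assumes large: "\<And>n m. \<bar>real_of_int n * \<alpha> - of_int m - \<gamma>\<bar> \<le> 2 * \<bar>d k\<bar> \<Longrightarrow>
      \<beta> / 4 < \<bar>of_int n\<bar> * \<bar>of_int n * \<alpha> - of_int m - \<gamma>\<bar>"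
    and k: "N < k"
  shows "\<exists>S T. cell \<gamma> k S T \<and> \<bar>S\<bar> \<le> 21 * x \<and> \<bar>T\<bar> \<le> 21 * x \<and>
    \<beta> * (1 + \<phi> k * \<theta> k) \<le> (1 + \<phi> k + S) * (1 - \<theta> k + T) \<and>
    \<beta> * (1 + \<phi> k * \<theta> k) \<le> (1 - \<phi> k - S) * (1 + \<theta> k + T) \<and>
    \<beta> * (1 + \<phi> k * \<theta> k) \<le> (1 - \<phi> k + S) * (1 + \<theta> k - T) \<and>
    \<beta> * (1 + \<phi> k * \<theta> k) \<le> (1 + \<phi> k - S) * (1 - \<theta> k - T)"
proof -
  let ?b = "\<beta> * (1 + \<phi> k * \<theta> k)"
  obtain \<xi> \<eta> :: real where c: "\<bar>\<xi>\<bar> \<le> 1" "\<bar>\<eta>\<bar> \<le> 1" "cell \<gamma> k (\<xi> + \<eta> * \<phi> k) (\<eta> - \<xi> * \<theta> k)"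
    by (rule cell_exists)
  define S T where "S = \<xi> + \<eta> * \<phi> k" and "T = \<eta> - \<xi> * \<theta> k"
  have cell: "cell \<gamma> k S T" using c(3) unfolding S_def T_def .
  have \<phi>b: "0 \<le> \<phi> k" "\<phi> k \<le> 11 / 10 * x" using \<phi>_bounds(1)[of k] \<phi>_le[OF k] by auto
  have \<theta>b: "0 \<le> \<theta> k" "\<theta> k \<le> 11 / 10 * x" using \<theta>_bounds(1)[of k] \<theta>_le[of k] k by auto
  have \<xi>\<theta>: "\<bar>\<xi> * \<theta> k\<bar> \<le> \<bar>\<xi>\<bar> * (11 / 10 * x)"
    unfolding abs_mult using \<theta>b by (intro mult_left_mono) auto
  have \<eta>\<phi>: "\<bar>\<eta> * \<phi> k\<bar> \<le> \<bar>\<eta>\<bar> * (11 / 10 * x)"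
    unfolding abs_mult using \<phi>b by (intro mult_left_mono) auto
  have "\<bar>\<xi>\<bar> * (11 / 10 * x) \<le> 1 * (11 / 10 * x)" using c x by (intro mult_right_mono) auto
  then have Tle: "\<bar>T\<bar> \<le> 2" unfolding T_def using c \<xi>\<theta> x by linarith
  have v: "?b \<le> \<bar>1 + \<phi> k + S\<bar> * \<bar>1 - \<theta> k + T\<bar>" "?b \<le> \<bar>-1 + \<phi> k + S\<bar> * \<bar>1 + \<theta> k + T\<bar>"
    "?b \<le> \<bar>1 - \<phi> k + S\<bar> * \<bar>-1 - \<theta> k + T\<bar>" "?b \<le> \<bar>-1 - \<phi> k + S\<bar> * \<bar>-1 + \<theta> k + T\<bar>"
  proof -
    note vertex = cell_vertices_large[OF cell large]
    have y: "\<bar>1 - \<theta> k + T\<bar> \<le> 4" "\<bar>1 + \<theta> k + T\<bar> \<le> 4" "\<bar>-1 - \<theta> k + T\<bar> \<le> 4" "\<bar>-1 + \<theta> k + T\<bar> \<le> 4"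
      using Tle \<theta>b x by linarith+
    show "?b \<le> \<bar>1 + \<phi> k + S\<bar> * \<bar>1 - \<theta> k + T\<bar>" using vertex[where i = 0 and j = 0] y(1) by (simp add: less_imp_le)
    show "?b \<le> \<bar>-1 + \<phi> k + S\<bar> * \<bar>1 + \<theta> k + T\<bar>" using vertex[where i = "-1" and j = 0] y(2) by (simp add: less_imp_le)
    show "?b \<le> \<bar>1 - \<phi> k + S\<bar> * \<bar>-1 - \<theta> k + T\<bar>" using vertex[where i = 0 and j = "-1"] y(3) by (simp add: less_imp_le)
    show "?b \<le> \<bar>-1 - \<phi> k + S\<bar> * \<bar>-1 + \<theta> k + T\<bar>"
      using vertex[where i = "-1" and j = "-1"] y(4) by (simp add: less_imp_le)
  qed
  have "1 - 3 * x \<le> \<beta>" unfolding \<beta>_def using small x by linarith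
  moreover have "\<beta> * 1 \<le> ?b" unfolding \<beta>_def using \<phi>b \<theta>b small x by (intro mult_left_mono) auto
  ultimately have b: "1 - 3 * x \<le> ?b" by linarith
  have "\<bar>\<xi>\<bar> \<le> 20 * x \<and> \<bar>\<eta>\<bar> \<le> 20 * x"
  proof -
    have e: "(1 + \<xi>) + (1 + \<eta>) * \<phi> k = 1 + \<phi> k + S" "(1 + \<eta>) - (1 + \<xi>) * \<theta> k = 1 - \<theta> k + T"
      "(-1 + \<xi>) + (1 + \<eta>) * \<phi> k = -1 + \<phi> k + S" "(1 + \<eta>) - (-1 + \<xi>) * \<theta> k = 1 + \<theta> k + T"
      "(1 + \<xi>) + (-1 + \<eta>) * \<phi> k = 1 - \<phi> k + S" "(-1 + \<eta>) - (1 + \<xi>) * \<theta> k = -1 - \<theta> k + T"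
      "(-1 + \<xi>) + (-1 + \<eta>) * \<phi> k = -1 - \<phi> k + S" "(-1 + \<eta>) - (-1 + \<xi>) * \<theta> k = -1 + \<theta> k + T"
      unfolding S_def T_def by (simp_all add: algebra_simps)
    have "\<phi> k \<le> 2 * x" "\<theta> k \<le> 2 * x" using \<phi>b \<theta>b x by linarith+
    then show ?thesis
      using vertices_force_small_center[OF x b \<phi>b(1) _ \<theta>b(1) _ c(1,2), unfolded e] v by blast
  qed
  then have \<xi>\<eta>: "\<bar>\<xi>\<bar> \<le> 20 * x" "\<bar>\<eta>\<bar> \<le> 20 * x" by auto
  have "\<bar>\<xi>\<bar> * (11 / 10 * x) \<le> 20 * x * (11 / 10 * x)" "\<bar>\<eta>\<bar> * (11 / 10 * x) \<le> 20 * x * (11 / 10 * x)"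
    using \<xi>\<eta> x by (intro mult_right_mono; simp)+
  then have "\<bar>\<xi>\<bar> * (11 / 10 * x) \<le> 22 * x\<^sup>2" "\<bar>\<eta>\<bar> * (11 / 10 * x) \<le> 22 * x\<^sup>2"
    by (simp_all add: power2_eq_square)
  then have ST: "\<bar>S\<bar> \<le> 21 * x" "\<bar>T\<bar> \<le> 21 * x"
    unfolding S_def T_def using \<xi>\<eta> \<xi>\<theta> \<eta>\<phi> small by linarith+
  then have abs: "\<bar>1 + \<phi> k + S\<bar> = 1 + \<phi> k + S" "\<bar>1 - \<theta> k + T\<bar> = 1 - \<theta> k + T"
    "\<bar>-1 + \<phi> k + S\<bar> = 1 - \<phi> k - S" "\<bar>1 + \<theta> k + T\<bar> = 1 + \<theta> k + T"
    "\<bar>1 - \<phi> k + S\<bar> = 1 - \<phi> k + S" "\<bar>-1 - \<theta> k + T\<bar> = 1 + \<theta> k - T"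
    "\<bar>-1 - \<phi> k + S\<bar> = 1 + \<phi> k - S" "\<bar>-1 + \<theta> k + T\<bar> = 1 - \<theta> k - T"
    using \<phi>b \<theta>b x by linarith+
  show ?thesis using cell ST v[unfolded abs] by blast
qed

text \<open>The pattern has to recur because the assumed bound takes effect only from some level on;
  a single occurrence beyond that level gives the contradiction.\<close>

lemma upper_bound:
  assumes \<gamma>: "\<gamma> \<notin> {real_of_int m + real_of_int k * \<alpha> | m k. True}"
    and block: "\<And>K. \<exists>L\<ge>K. a (Suc L) = R\<^sub>e \<and> a (Suc (Suc L)) = R\<^sub>o \<and> a (Suc (Suc (Suc L))) = R\<^sub>o \<and>
      a (Suc (Suc (Suc (Suc L)))) = R\<^sub>o \<and> a (Suc (Suc (Suc (Suc (Suc L))))) = R\<^sub>o \<and>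
      a (Suc (Suc (Suc (Suc (Suc (Suc L)))))) = R\<^sub>e"
  shows "approx_const \<alpha> \<gamma> \<le> ereal ((1 - 2 * x - 2 * x\<^sup>2 + 80 * x ^ 3) / 4)"
proof (rule ccontr)
  let ?\<beta> = "1 - 2 * x - 2 * x\<^sup>2 + 80 * x ^ 3"
  assume "\<not> ?thesis"
  then have "ereal (?\<beta> / 4) < approx_const \<alpha> \<gamma>" by simp
  from grid_eventually_large[OF \<gamma> this] obtain K where
    K: "\<And>k n m. K \<le> k \<Longrightarrow> \<bar>real_of_int n * \<alpha> - of_int m - \<gamma>\<bar> \<le> 2 * \<bar>d k\<bar> \<Longrightarrow>
    ?\<beta> / 4 < \<bar>of_int n\<bar> * \<bar>of_int n * \<alpha> - of_int m - \<gamma>\<bar>" by blast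
  define M where "M = max K (Suc N)"
  have MN: "N < k" "N \<le> k" if "M \<le> k" for k using that unfolding M_def by auto
  define good where "good k S T \<longleftrightarrow> cell \<gamma> k S T \<and> \<bar>S\<bar> \<le> 21 * x \<and> \<bar>T\<bar> \<le> 21 * x \<and>
    ?\<beta> * (1 + \<phi> k * \<theta> k) \<le> (1 + \<phi> k + S) * (1 - \<theta> k + T) \<and>
    ?\<beta> * (1 + \<phi> k * \<theta> k) \<le> (1 - \<phi> k - S) * (1 + \<theta> k + T) \<and>
    ?\<beta> * (1 + \<phi> k * \<theta> k) \<le> (1 - \<phi> k + S) * (1 + \<theta> k - T) \<and>
    ?\<beta> * (1 + \<phi> k * \<theta> k) \<le> (1 + \<phi> k - S) * (1 - \<theta> k - T)" for k S T
  have "\<forall>k. \<exists>S T. M \<le> k \<longrightarrow> good k S T"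
  proof
    fix k
    show "\<exists>S T. M \<le> k \<longrightarrow> good k S T"
    proof (cases "M \<le> k")
      case True
      have "\<exists>S T. good k S T" unfolding good_def
        by (rule level_center) (use K[of k] True MN[OF True] in \<open>auto simp: M_def\<close>)
      then show ?thesis by blast
    qed simp
  qed
  then obtain S T :: "nat \<Rightarrow> real" where good: "\<And>k. M \<le> k \<Longrightarrow> good k (S k) (T k)"
    by metis
  have cell: "cell \<gamma> k (S k) (T k)" and Sb: "\<bar>S k\<bar> \<le> 21 * x" and Tb: "\<bar>T k\<bar> \<le> 21 * x"
    and v: "?\<beta> * (1 + \<phi> k * \<theta> k) \<le> (1 + \<phi> k + S k) * (1 - \<theta> k + T k)"
      "?\<beta> * (1 + \<phi> k * \<theta> k) \<le> (1 - \<phi> k - S k) * (1 + \<theta> k + T k)"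
      "?\<beta> * (1 + \<phi> k * \<theta> k) \<le> (1 - \<phi> k + S k) * (1 + \<theta> k - T k)"
      "?\<beta> * (1 + \<phi> k * \<theta> k) \<le> (1 + \<phi> k - S k) * (1 - \<theta> k - T k)" if "M \<le> k" for k
    using good[OF that] unfolding good_def by blast+
  have "\<exists>\<tau>::int. S (Suc k) = \<phi> (Suc k) * (\<tau> + S k) \<and> T k = \<theta> k * (\<tau> - T (Suc k)) \<and>
      even (a (Suc k) + \<tau>)" if "M \<le> k" for k
  proof -
    have k': "M \<le> Suc k" using that by simp
    have p: "9 / 10 * x \<le> \<phi> (Suc k)" using \<phi>_near(1)[OF MN(1)[OF k']] small x by linarith
    have "21 * x \<le> 24 * \<phi> (Suc k)" using p x by linarith
    then have "\<bar>S (Suc k)\<bar> / \<phi> (Suc k) \<le> 24"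
      using Sb[OF k'] \<phi>_pos[of k] by (simp add: divide_le_eq)
    then have "\<theta> k * (\<bar>S (Suc k)\<bar> / \<phi> (Suc k) + \<bar>S k\<bar> + \<bar>T (Suc k)\<bar>) \<le> (11 / 10 * x) * 26"
      using \<theta>_le[OF MN(2)[OF that]] Sb[OF that] Tb[OF k'] x \<phi>_pos[of k] by (intro mult_mono) auto
    then have "\<theta> k * (\<bar>S (Suc k)\<bar> / \<phi> (Suc k) + \<bar>S k\<bar> + \<bar>T (Suc k)\<bar>) + \<bar>T k\<bar> < 2"
      using Tb[OF that] x by linarith
    from cell_relation[OF cell[OF that] cell[OF k'] this] show ?thesis by blast
  qed
  then have "\<forall>k. \<exists>\<tau>::int. M \<le> k \<longrightarrow> S (Suc k) = \<phi> (Suc k) * (\<tau> + S k) \<and>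
      T k = \<theta> k * (\<tau> - T (Suc k)) \<and> even (a (Suc k) + \<tau>)" by blast
  \<comment> \<open>\<open>\<sigma> k\<close> is the digit of the quotient \<open>a (Suc k)\<close>,
    shifted by one against the digits in \<open>lower_bound\<close>.\<close>
  then obtain \<sigma> :: "nat \<Rightarrow> int" where \<sigma>: "\<And>k. M \<le> k \<Longrightarrow> S (Suc k) = \<phi> (Suc k) * (\<sigma> k + S k) \<and>
      T k = \<theta> k * (\<sigma> k - T (Suc k)) \<and> even (a (Suc k) + \<sigma> k)" by metis
  have S: "S (Suc k) = \<phi> (Suc k) * (\<sigma> k + S k)" and T: "T k = \<theta> k * (\<sigma> k - T (Suc k))"
    and parity: "even (a (Suc k) + \<sigma> k)" if "M \<le> k" for k
    using \<sigma>[OF that] by blast+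
  have digits: "\<bar>\<sigma> k\<bar> + \<bar>\<sigma> (Suc k)\<bar> \<le> 2" if "M \<le> k" for k
  proof (rule ccontr)
    assume "\<not> ?thesis"
    then have "3 \<le> \<bar>\<sigma> k\<bar> + \<bar>\<sigma> (Suc k)\<bar>" by simp
    then have three: "3 \<le> \<bar>real_of_int (\<sigma> k)\<bar> + \<bar>real_of_int (\<sigma> (Suc k))\<bar>" by linarith
    let ?k = "Suc k"
    have k': "M \<le> ?k" "M \<le> Suc ?k" using that by auto
    have near: "x - 2 * x\<^sup>2 \<le> \<phi> ?k" "\<phi> ?k \<le> x + 2 * x\<^sup>2" "x - 2 * x\<^sup>2 \<le> \<theta> ?k" "\<theta> ?k \<le> x + 2 * x\<^sup>2"
      using \<phi>_near[OF MN(1)[OF k'(1)]] \<theta>_near[OF MN(2)[OF k'(1)]] by auto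
    have pt: "0 \<le> \<phi> ?k" "0 \<le> \<theta> ?k" "\<phi> ?k \<le> 11 / 10 * x" "\<theta> ?k \<le> 11 / 10 * x"
      using \<phi>_bounds(1)[of ?k] \<theta>_bounds(1)[of ?k] \<phi>_le[OF MN(1)[OF k'(1)]] \<theta>_le[OF MN(2)[OF k'(1)]]
      by (auto simp del: \<theta>.simps)
    have "1 - 2 * x - 2 * x\<^sup>2 \<le> ?\<beta> * 1" using x by simp
    also have "\<dots> \<le> ?\<beta> * (1 + \<phi> ?k * \<theta> ?k)"
      using pt small x by (intro mult_left_mono) auto
    finally have b: "1 - 2 * x - 2 * x\<^sup>2 \<le> ?\<beta> * (1 + \<phi> ?k * \<theta> ?k)" .
    have sum: "\<bar>S ?k\<bar> + \<bar>T ?k\<bar> \<le> 2 * x + 550 * x\<^sup>2"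
      by (rule vertices_force_digit_sum[OF x b near Sb[OF k'(1)] Tb[OF k'(1)] v[OF k'(1)]])
    have "\<phi> ?k * \<bar>S k\<bar> \<le> (11 / 10 * x) * (21 * x)" "\<theta> ?k * \<bar>T (Suc ?k)\<bar> \<le> (11 / 10 * x) * (21 * x)"
      using pt Sb[OF that] Tb[OF k'(2)] x by (intro mult_mono; simp del: \<theta>.simps)+
    then have small': "\<phi> ?k * \<bar>S k\<bar> \<le> 24 * x\<^sup>2" "\<theta> ?k * \<bar>T (Suc ?k)\<bar> \<le> 24 * x\<^sup>2"
      using small(1) by (auto simp: power2_eq_square simp del: \<theta>.simps)
    have "\<phi> ?k * \<bar>real_of_int (\<sigma> k)\<bar> = \<bar>S ?k - \<phi> ?k * S k\<bar>"
      unfolding S[OF that] using pt(1) by (simp add: algebra_simps abs_mult)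
    also have "\<dots> \<le> \<bar>S ?k\<bar> + \<bar>\<phi> ?k * S k\<bar>" by (rule abs_triangle_ineq4)
    also have "\<bar>\<phi> ?k * S k\<bar> = \<phi> ?k * \<bar>S k\<bar>" using pt(1) by (simp add: abs_mult)
    finally have 1: "\<phi> ?k * \<bar>real_of_int (\<sigma> k)\<bar> \<le> \<bar>S ?k\<bar> + 24 * x\<^sup>2" using small'(1) by linarith
    have "\<theta> ?k * \<bar>real_of_int (\<sigma> ?k)\<bar> = \<bar>T ?k + \<theta> ?k * T (Suc ?k)\<bar>"
      unfolding T[OF k'(1)] using pt(2) by (simp add: algebra_simps abs_mult del: \<theta>.simps)
    also have "\<dots> \<le> \<bar>T ?k\<bar> + \<bar>\<theta> ?k * T (Suc ?k)\<bar>" by (rule abs_triangle_ineq)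
    also have "\<bar>\<theta> ?k * T (Suc ?k)\<bar> = \<theta> ?k * \<bar>T (Suc ?k)\<bar>" using pt(2) by (simp add: abs_mult del: \<theta>.simps)
    finally have 2: "\<theta> ?k * \<bar>real_of_int (\<sigma> ?k)\<bar> \<le> \<bar>T ?k\<bar> + 24 * x\<^sup>2" using small'(2) by linarith
    \<comment> \<open>A digit sum of 3 needs \<open>3 * x\<close> where only \<open>2 * x\<close> is
      available to first order. Here 598 is 550 + 24 + 24, and \<open>x \<le> 1 / 1000\<close> beats
      the resulting 604.\<close>
    have "(x - 2 * x\<^sup>2) * 3 \<le> (x - 2 * x\<^sup>2) * (\<bar>real_of_int (\<sigma> k)\<bar> + \<bar>real_of_int (\<sigma> ?k)\<bar>)"
      using three small x by (intro mult_left_mono) auto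
    also have "\<dots> = (x - 2 * x\<^sup>2) * \<bar>real_of_int (\<sigma> k)\<bar> + (x - 2 * x\<^sup>2) * \<bar>real_of_int (\<sigma> ?k)\<bar>"
      by (rule distrib_left)
    also have "\<dots> \<le> \<phi> ?k * \<bar>real_of_int (\<sigma> k)\<bar> + \<theta> ?k * \<bar>real_of_int (\<sigma> ?k)\<bar>"
      using near by (intro add_mono mult_right_mono) auto
    finally have "(x - 2 * x\<^sup>2) * 3 \<le> 2 * x + 598 * x\<^sup>2" using 1 2 sum by linarith
    then have "x \<le> 604 * x\<^sup>2" by (simp add: left_diff_distrib)
    then show False using small(2) x(1) by linarith
  qed
  obtain L where L: "M \<le> L" "a (Suc L) = R\<^sub>e" "a (Suc (Suc L)) = R\<^sub>o" "a (Suc (Suc (Suc L))) = R\<^sub>o"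
      "a (Suc (Suc (Suc (Suc L)))) = R\<^sub>o" "a (Suc (Suc (Suc (Suc (Suc L))))) = R\<^sub>o"
      "a (Suc (Suc (Suc (Suc (Suc (Suc L)))))) = R\<^sub>e"
    using block[of M] by blast
  define l1 l2 l3 l4 l5 where "l1 = Suc L" and "l2 = Suc l1" and "l3 = Suc l2" and "l4 = Suc l3" and "l5 = Suc l4"
  note l_defs = l1_def l2_def l3_def l4_def l5_def
  have Ml: "M \<le> l1" "M \<le> l2" "M \<le> l3" "M \<le> l4" "M \<le> l5" using L(1) unfolding l_defs by auto
  have evenR: "even R\<^sub>e" using R\<^sub>o R\<^sub>e by auto
  have "even (\<sigma> L)" "odd (\<sigma> l1)" "odd (\<sigma> l2)" "odd (\<sigma> l3)" "odd (\<sigma> l4)" "even (\<sigma> l5)"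
    using parity[OF L(1)] parity[OF Ml(1)] parity[OF Ml(2)] parity[OF Ml(3)] parity[OF Ml(4)] parity[OF Ml(5)]
      L evenR R\<^sub>o(1) unfolding l_defs by auto
  moreover have "\<bar>\<sigma> L\<bar> + \<bar>\<sigma> l1\<bar> \<le> 2" "\<bar>\<sigma> l1\<bar> + \<bar>\<sigma> l2\<bar> \<le> 2" "\<bar>\<sigma> l2\<bar> + \<bar>\<sigma> l3\<bar> \<le> 2"
    "\<bar>\<sigma> l3\<bar> + \<bar>\<sigma> l4\<bar> \<le> 2" "\<bar>\<sigma> l4\<bar> + \<bar>\<sigma> l5\<bar> \<le> 2"
    using digits[OF L(1)] digits[OF Ml(1)] digits[OF Ml(2)] digits[OF Ml(3)] digits[OF Ml(4)]
    unfolding l_defs by auto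
  \<comment> \<open>Each odd digit of the block has an odd neighbour, so it is a unit; an even digit
    beside an odd one vanishes.\<close>
  moreover have unit: "p = 1 \<or> p = -1" if "odd p" "odd q" "\<bar>p\<bar> + \<bar>q\<bar> \<le> 2" for p q :: int
    using that by presburger
  moreover have null: "p = 0" if "even p" "odd q" "\<bar>p\<bar> + \<bar>q\<bar> \<le> 2" for p q :: int
    using that by presburger
  ultimately have \<sigma>0: "\<sigma> L = 0" "\<sigma> l5 = 0" and \<sigma>1: "\<sigma> l1 = 1 \<or> \<sigma> l1 = -1" "\<sigma> l2 = 1 \<or> \<sigma> l2 = -1"
    "\<sigma> l3 = 1 \<or> \<sigma> l3 = -1" "\<sigma> l4 = 1 \<or> \<sigma> l4 = -1"
    by (metis add.commute)+
  \<comment> \<open>Multiplying the recursion by the unit digit gives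
    \<open>\<phi> (Suc k) * (1 + \<sigma> k * S k)\<close>, so an \<open>e\<close> close to
    \<open>x\<close> produces the extra \<open>x\<^sup>2\<close>.\<close>
  have S_unit: "(x - 2 * x ^ 3) * (1 + e) \<le> \<sigma> k * S (Suc k)" if "M \<le> k" "a (Suc k) = R\<^sub>o"
    "\<sigma> k = 1 \<or> \<sigma> k = -1" "e \<le> \<sigma> k * S k" "-1 \<le> e" for k e
  proof -
    have "(x - 2 * x ^ 3) * (1 + e) \<le> \<phi> (Suc k) * (1 + \<sigma> k * S k)"
      using \<phi>_close[of "Suc k"] MN[OF that(1)] that small x \<phi>_pos[of k] by (intro mult_mono) auto
    also have "\<dots> = \<sigma> k * S (Suc k)" unfolding S[OF that(1)] using that(3) by auto
    finally show ?thesis .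
  qed
  have T_unit: "(x - 2 * x ^ 3) * (1 + e) \<le> \<sigma> k * T k" if "M \<le> k" "a (Suc k) = R\<^sub>o"
    "\<sigma> k = 1 \<or> \<sigma> k = -1" "e \<le> - \<sigma> k * T (Suc k)" "-1 \<le> e" for k e
  proof -
    have "(x - 2 * x ^ 3) * (1 + e) \<le> \<theta> k * (1 + - \<sigma> k * T (Suc k))"
      using \<theta>_close[of k] MN[OF that(1)] that small x \<theta>_bounds(1)[of k] by (intro mult_mono) auto
    also have "\<dots> = \<sigma> k * T k" unfolding T[OF that(1)] using that(3) by auto
    finally show ?thesis .
  qed
  have unit_bound: "- c \<le> s * z" if "\<bar>z\<bar> \<le> c" "s = 1 \<or> s = -1" for s z c :: real
    using that by auto
  have p1: "x - 30 * x ^ 3 \<le> (x - 2 * x ^ 3) * (1 + - (24 * x\<^sup>2))"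
  proof -
    have "(x - 2 * x ^ 3) * (1 + - (24 * x\<^sup>2)) = x - 26 * x ^ 3 + 48 * x ^ 5" by algebra
    then show ?thesis using small by linarith
  qed
  have p2: "x - 22 * x\<^sup>2 \<le> (x - 2 * x ^ 3) * (1 + - (21 * x))"
  proof -
    have "(x - 2 * x ^ 3) * (1 + - (21 * x)) = x - 21 * x ^ 2 - 2 * x ^ 3 + 42 * x ^ 4" by algebra
    then show ?thesis using small by linarith
  qed
  have p3: "x + x\<^sup>2 - 30 * x ^ 3 \<le> (x - 2 * x ^ 3) * (1 + (x - 22 * x\<^sup>2))"
  proof -
    have "(x - 2 * x ^ 3) * (1 + (x - 22 * x\<^sup>2)) = x + x ^ 2 - 24 * x ^ 3 - 2 * x ^ 4 + 44 * x ^ 5" by algebra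
    then show ?thesis using small by linarith
  qed
  have r: "real_of_int (\<sigma> l1) = 1 \<or> real_of_int (\<sigma> l1) = -1" "real_of_int (\<sigma> l2) = 1 \<or> real_of_int (\<sigma> l2) = -1"
    "real_of_int (\<sigma> l3) = 1 \<or> real_of_int (\<sigma> l3) = -1" "real_of_int (\<sigma> l4) = 1 \<or> real_of_int (\<sigma> l4) = -1"
    using \<sigma>1 by auto
  have al: "a (Suc l1) = R\<^sub>o" "a (Suc l2) = R\<^sub>o" "a (Suc l3) = R\<^sub>o" "a (Suc l4) = R\<^sub>o"
    using L unfolding l_defs by auto
  have ge: "-1 \<le> - (24 * x\<^sup>2)" "-1 \<le> - (21 * x)" "-1 \<le> x - 22 * x\<^sup>2" using small x by linarith+
  have Nl2: "Suc N < l2" "a l2 = R\<^sub>o" and Nl4: "Suc N < l4" "a l4 = R\<^sub>o"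
    using al MN(1)[OF Ml(1)] MN(1)[OF Ml(3)] unfolding l2_def l4_def by auto
  consider "\<sigma> l2 = - \<sigma> l3" | "\<sigma> l2 = \<sigma> l3" using \<sigma>1 by auto
  then show False
  proof cases
    case 1
    \<comment> \<open>Opposite middle digits, level \<open>l2\<close>: the zero digit
      \<open>\<sigma> L\<close> makes \<open>S l1\<close> quadratic, so \<open>S l2\<close> loses
      only a cubic term, and the sign of \<open>\<sigma> l3\<close> gives \<open>T l2\<close> the
      extra \<open>x\<^sup>2\<close>.\<close>
    have "\<bar>S l1\<bar> = \<phi> l1 * \<bar>S L\<bar>" using S[OF L(1)] \<sigma>0 \<phi>_bounds(1)[of l1] unfolding l1_def by (simp add: abs_mult)
    also have "\<dots> \<le> (11 / 10 * x) * (21 * x)"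
      using \<phi>_le[OF MN(1)[OF Ml(1)]] Sb[OF L(1)] x by (intro mult_mono) auto
    also have "\<dots> \<le> 24 * x\<^sup>2" by (simp add: power2_eq_square)
    finally have "x - 30 * x ^ 3 \<le> \<sigma> l1 * S l2"
      using S_unit[OF Ml(1) al(1) \<sigma>1(1) unit_bound[OF _ r(1)] ge(1)] p1 unfolding l2_def by force
    moreover have "x - 22 * x\<^sup>2 \<le> \<sigma> l3 * T l3"
      using T_unit[OF Ml(3) al(3) \<sigma>1(3) _ ge(2)] unit_bound[OF Tb[OF Ml(4)], of "- \<sigma> l3"] r(3) p2
      unfolding l4_def by force
    then have "x + x\<^sup>2 - 30 * x ^ 3 \<le> \<sigma> l2 * T l2"
      using T_unit[OF Ml(2) al(2) \<sigma>1(2) _ ge(3)] p3 1 unfolding l3_def by force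
    ultimately show False
      by (intro vertices_upper[OF x \<phi>_close[OF Nl2] \<theta>_close[OF MN(2)[OF Ml(2)] al(2)]
            Sb[OF Ml(2)] Tb[OF Ml(2)] v[OF Ml(2)] r(1,2), of 0]) simp_all
  next
    case 2
    \<comment> \<open>Equal middle digits are the mirror image at level \<open>l4\<close>:
      \<open>S l4\<close> gains the extra \<open>x\<^sup>2\<close>, and the zero digit
      \<open>\<sigma> l5\<close> makes \<open>T l5\<close> quadratic.\<close>
    have "x - 22 * x\<^sup>2 \<le> \<sigma> l2 * S l3"
      using S_unit[OF Ml(2) al(2) \<sigma>1(2) _ ge(2)] unit_bound[OF Sb[OF Ml(2)] r(2)] p2
      unfolding l3_def by force
    then have "x + x\<^sup>2 - 30 * x ^ 3 \<le> \<sigma> l3 * S l4"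
      using S_unit[OF Ml(3) al(3) \<sigma>1(3) _ ge(3)] p3 2 unfolding l4_def by force
    moreover have "\<bar>T l5\<bar> = \<theta> l5 * \<bar>T (Suc l5)\<bar>" using T[OF Ml(5)] \<sigma>0 \<theta>_bounds(1)[of l5]
      by (simp add: abs_mult del: \<theta>.simps)
    moreover have "\<theta> l5 * \<bar>T (Suc l5)\<bar> \<le> (11 / 10 * x) * (21 * x)"
      using \<theta>_le[OF MN(2)[OF Ml(5)]] Tb[of "Suc l5"] Ml(5) x by (intro mult_mono) auto
    moreover have "(11 / 10 * x) * (21 * x) \<le> 24 * x\<^sup>2" by (simp add: power2_eq_square)
    ultimately have S4: "x + x\<^sup>2 - 30 * x ^ 3 \<le> \<sigma> l3 * S l4" and T5: "\<bar>T l5\<bar> \<le> 24 * x\<^sup>2" by linarith+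
    have "x - 30 * x ^ 3 \<le> \<sigma> l4 * T l4"
      using T_unit[OF Ml(4) al(4) \<sigma>1(4) _ ge(1)] unit_bound[OF T5, of "- \<sigma> l4"] r(4) p1
      unfolding l5_def by force
    with S4 show False
      by (intro vertices_upper[OF x \<phi>_close[OF Nl4] \<theta>_close[OF MN(2)[OF Ml(4)] al(4)]
            Sb[OF Ml(4)] Tb[OF Ml(4)] v[OF Ml(4)] r(3,4), of 1]) simp_all
  qed
qed

end

section \<open>Crude bounds for \<open>rho\<close> and the conclusion\<close>

lemma ereal_abs_diff_leI:
  assumes "ereal (b - c) \<le> r" "r \<le> ereal (b + c)"
  shows "\<bar>r - ereal b\<bar> \<le> ereal c"
  using assms by (cases r) auto

lemma (in irrational_cf) rho_le_2: "rho \<alpha> \<le> ereal 2"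
  unfolding rho_def by (rule SUP_least) (auto intro: approx_const_le_2)

text \<open>An empty supremum would be negative infinity, so an admissible \<gamma> has to be
  exhibited; \<open>\<alpha> / 2\<close> is one by irrationality.\<close>

lemma (in irrational_cf) rho_nonneg: "0 \<le> rho \<alpha>"
proof -
  have "\<alpha> / 2 \<notin> {real_of_int m + real_of_int k * \<alpha> | m k. True}"
  proof
    assume "\<alpha> / 2 \<in> {real_of_int m + real_of_int k * \<alpha> | m k. True}"
    then obtain m k :: int where "\<alpha> / 2 = m + k * \<alpha>" by blast
    then have eq: "real_of_int (1 - 2 * k) * \<alpha> = real_of_int (2 * m)" by (simp add: algebra_simps)
    have "1 - 2 * k \<noteq> 0" by presburger
    then have "\<alpha> = real_of_int (2 * m) / real_of_int (1 - 2 * k)"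
      unfolding eq[symmetric] by (metis nonzero_mult_div_cancel_left of_int_eq_0_iff)
    then have "\<alpha> \<in> \<rat>" by (metis Rats_divide Rats_of_int)
    with irrational show False ..
  qed
  then have "approx_const \<alpha> (\<alpha> / 2) \<le> rho \<alpha>" unfolding rho_def by (intro SUP_upper) simp
  moreover have "ereal 0 \<le> approx_const \<alpha> (\<alpha> / 2)" by (rule approx_const_geI[where N = 0]) simp
  ultimately show ?thesis by (simp add: zero_ereal_def) 
qed

theorem theorem6:
  shows "\<exists>C::real. C > 0 \<and>
    (\<forall>(R::int) (Rodd::int) (Reven::int) (\<alpha>::real) (a::nat \<Rightarrow> int).
       R \<ge> 2 \<longrightarrow>
       Rodd \<in> {R, R + 1} \<longrightarrow> odd Rodd \<longrightarrow>
       Reven \<in> {R, R + 1} \<longrightarrow> even Reven \<longrightarrow>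
       \<alpha> \<notin> \<rat> \<longrightarrow>
       regular_cf \<alpha> a \<longrightarrow>
       eventually_periodic [Reven, Rodd, Rodd, Rodd, Rodd] a \<longrightarrow>
       \<bar>rho \<alpha> - ereal (1 / 4 * (1 - 2 / real_of_int Rodd - 2 / (real_of_int Rodd)\<^sup>2))\<bar>
         \<le> ereal (C / (real_of_int Rodd) ^ 3))"
proof (intro exI[of _ "3 * 10 ^ 9"] conjI allI impI)
  fix R Rodd Reven :: int and \<alpha> :: real and a :: "nat \<Rightarrow> int"
  assume R: "R \<ge> 2" and o: "Rodd \<in> {R, R + 1}" "odd Rodd" and e: "Reven \<in> {R, R + 1}" "even Reven"
    and \<alpha>: "\<alpha> \<notin> \<rat>" "regular_cf \<alpha> a"
    and periodic: "eventually_periodic [Reven, Rodd, Rodd, Rodd, Rodd] a"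
  interpret irrational_cf \<alpha> a using \<alpha> by unfold_locales
  define x where "x = 1 / real_of_int Rodd"
  define b where "b = 1 / 4 * (1 - 2 * x - 2 * x\<^sup>2)"
  have "2 \<le> real_of_int Rodd" using R o by auto
  then have x: "0 < x" "x \<le> 1 / 2" unfolding x_def by (auto simp: divide_simps)
  have "ereal (b - 3 * 10 ^ 9 * x ^ 3) \<le> rho \<alpha> \<and> rho \<alpha> \<le> ereal (b + 3 * 10 ^ 9 * x ^ 3)"
  proof (cases "Rodd < 1000")
    case True
    then have "1 / 1000 \<le> x" unfolding x_def using \<open>2 \<le> real_of_int Rodd\<close> by (simp add: divide_simps)
    then have "(1 / 1000) ^ 3 \<le> x ^ 3" by (intro power_mono) auto
    \<comment> \<open>The constant \<open>3 * 10 ^ 9\<close> makes the error term at least 3 here,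
      the widest gap possible between \<open>rho\<close> in \<open>[0, 2]\<close> and
      \<open>b\<close> in \<open>[-1, 1]\<close>.\<close>
    then have c: "3 \<le> 3 * 10 ^ 9 * x ^ 3" by (simp add: power_divide)
    have "x\<^sup>2 \<le> (1 / 2)\<^sup>2" using x by (intro power_mono) auto
    then have "0 \<le> x\<^sup>2" "x\<^sup>2 \<le> 1 / 4" by (auto simp: power_divide)
    then have "- 4 \<le> 1 - 2 * x - 2 * x\<^sup>2" "1 - 2 * x - 2 * x\<^sup>2 \<le> 4" using x by linarith+
    then have "-1 \<le> b" "b \<le> 1" unfolding b_def by simp_all
    then have "b - 3 * 10 ^ 9 * x ^ 3 \<le> 0" "2 \<le> b + 3 * 10 ^ 9 * x ^ 3" using c by linarith+
    then have "ereal (b - 3 * 10 ^ 9 * x ^ 3) \<le> ereal 0" "ereal 2 \<le> ereal (b + 3 * 10 ^ 9 * x ^ 3)"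
      by (simp_all only: ereal_less_eq(3))
    then show ?thesis using rho_nonneg rho_le_2 unfolding zero_ereal_def by (blast intro: order_trans)
  next
    case False
    obtain N where N: "\<And>k. a (N + k) = [Reven, Rodd, Rodd, Rodd, Rodd] ! (k mod 5)"
      using periodic unfolding eventually_periodic_def by auto
    have nth: "[Reven, Rodd, Rodd, Rodd, Rodd] ! j = (if j = 0 then Reven else Rodd)" if "j < 5" for j
      using that by (auto simp: less_Suc_eq numeral_eq_Suc)
    have aN: "a (N + k) = (if k mod 5 = 0 then Reven else Rodd)" for k
      unfolding N by (rule nth) simp
    interpret two_quotient_cf \<alpha> a N Rodd Reven x
    proof unfold_locales
      show "a k = Rodd \<or> a k = Reven" if "N \<le> k" for k
        using aN[of "k - N"] that by auto
      show "Reven = Rodd - 1 \<or> Reven = Rodd + 1" using o e by auto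
    qed (use o False x_def in auto)
    have cube: "0 < x ^ 3" using x by simp
    have lower: "b - 3 * 10 ^ 9 * x ^ 3 \<le> (1 - 2 * x - 2 * x\<^sup>2 - 20 * x ^ 3) / 4"
      and upper: "(1 - 2 * x - 2 * x\<^sup>2 + 80 * x ^ 3) / 4 \<le> b + 3 * 10 ^ 9 * x ^ 3"
      using cube unfolding b_def by (simp_all add: field_simps)
    have "a k = Rodd \<or> a (Suc k) = Rodd" if "N \<le> k" for k
    proof -
      have "(k - N) mod 5 \<noteq> 0 \<or> Suc (k - N) mod 5 \<noteq> 0" by presburger
      then show ?thesis using aN[of "k - N"] aN[of "Suc (k - N)"] that by auto
    qed
    then obtain \<gamma> where \<gamma>: "\<gamma> \<notin> {real_of_int m + real_of_int k * \<alpha> | m k. True}"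
      "ereal ((1 - 2 * x - 2 * x\<^sup>2 - 20 * x ^ 3) / 4) \<le> approx_const \<alpha> \<gamma>"
      using lower_bound by blast
    have "approx_const \<alpha> \<gamma> \<le> rho \<alpha>" unfolding rho_def using \<gamma>(1) by (intro SUP_upper) simp
    with \<gamma>(2) have "ereal ((1 - 2 * x - 2 * x\<^sup>2 - 20 * x ^ 3) / 4) \<le> rho \<alpha>" by (rule order_trans)
    moreover have "\<exists>L\<ge>K. a (Suc L) = Reven \<and> a (Suc (Suc L)) = Rodd \<and> a (Suc (Suc (Suc L))) = Rodd \<and>
      a (Suc (Suc (Suc (Suc L)))) = Rodd \<and> a (Suc (Suc (Suc (Suc (Suc L))))) = Rodd \<and>
      a (Suc (Suc (Suc (Suc (Suc (Suc L)))))) = Reven" for K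
    proof -
      have "a (N + 5 * K + i) = (if i mod 5 = 0 then Reven else Rodd)" for i
        using aN[of "5 * K + i"] by (simp add: add.assoc)
      note shifted = this[of 5] this[of 6] this[of 7] this[of 8] this[of 9] this[of 10]
      have "Suc (N + 5 * K + 4) = N + 5 * K + 5" "Suc (N + 5 * K + 5) = N + 5 * K + 6"
        "Suc (N + 5 * K + 6) = N + 5 * K + 7" "Suc (N + 5 * K + 7) = N + 5 * K + 8"
        "Suc (N + 5 * K + 8) = N + 5 * K + 9" "Suc (N + 5 * K + 9) = N + 5 * K + 10" by simp_all
      \<comment> \<open>The offset 4 puts \<open>Suc L\<close> at the start of a period.\<close>
      then show ?thesis by (intro exI[of _ "N + 5 * K + 4"]) (simp only: shifted, simp)
    qed
    then have "approx_const \<alpha> \<gamma> \<le> ereal ((1 - 2 * x - 2 * x\<^sup>2 + 80 * x ^ 3) / 4)"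
      if "\<gamma> \<notin> {real_of_int m + real_of_int k * \<alpha> | m k. True}" for \<gamma>
      using upper_bound that by blast
    then have "rho \<alpha> \<le> ereal ((1 - 2 * x - 2 * x\<^sup>2 + 80 * x ^ 3) / 4)"
      unfolding rho_def by (intro SUP_least) simp
    moreover have "ereal (b - 3 * 10 ^ 9 * x ^ 3) \<le> ereal ((1 - 2 * x - 2 * x\<^sup>2 - 20 * x ^ 3) / 4)"
      "ereal ((1 - 2 * x - 2 * x\<^sup>2 + 80 * x ^ 3) / 4) \<le> ereal (b + 3 * 10 ^ 9 * x ^ 3)"
      using lower upper by (simp_all only: ereal_less_eq(3))
    ultimately show ?thesis by (blast intro: order_trans)
  qed
  then have "\<bar>rho \<alpha> - ereal b\<bar> \<le> ereal (3 * 10 ^ 9 * x ^ 3)" by (blast intro: ereal_abs_diff_leI)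
  then show "\<bar>rho \<alpha> - ereal (1 / 4 * (1 - 2 / real_of_int Rodd - 2 / (real_of_int Rodd)\<^sup>2))\<bar>
      \<le> ereal (3 * 10 ^ 9 / (real_of_int Rodd) ^ 3)"
    unfolding b_def x_def by (simp add: power_divide)
qed simp

end
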